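(* Let $\Theta$ be a first-order signature and let $\Gamma\cup\{\varphi\}\subseteq For(\Theta)$. If $\Gamma\models_{\mathbf{QmbC}}\varphi$ (semantical consequence with respect to first-order swap structures), then $\Gamma\vdash_{\mathbf{QmbC}}\varphi$.
   Context: **Language.** $Var$ is a denumerable set of individual variables. A first-order signature $\Theta$ consists of a set $\mathcal C$ of individual constants and, for each $n\ge 1$, sets $\mathcal F_n$ and $\mathcal P_n$ of function and predicate symbols of arity $n$ (with at least one predicate symbol). Formulas are built with binary connectives $\wedge,\vee,\to$, unary connectives $\neg,\circ$, and quantifiers $\forall,\exists$. $Ter(\Theta)$, $CTer(\Theta)$, $For(\Theta)$, $Sen(\Theta)$ are the sets of terms, closed terms, formulas and sentences. $\varphi[x/t]$ is the result of replacing every free occurrence of $x$ in $\varphi$ by $t$. Two formulas are *variants* if one is obtained from the other by addition or deletion of void quantifiers, or by renaming bound variables (keeping the same free variables in the same places). **Calculus QmbC** (Hilbert calculus over $For(\Theta)$). Axiom schemas: (A1) $\alpha\to(\beta\to\alpha)$; (A2) $(\alpha\to(\beta\to\gamma))\to((\alpha\to\beta)\to(\alpha\to\gamma))$; (A3) $\alpha\to(\beta\to(\alpha\wedge\beta))$; (A4) $(\alpha\wedge\beta)\to\alpha$; (A5) $(\alpha\wedge\beta)\to\beta$; (A6) $\alpha\to(\alpha\vee\beta)$; (A7) $\beta\to(\alpha\vee\beta)$; (A8) $(\alpha\to\gamma)\to((\beta\to\gamma)\to((\alpha\vee\beta)\to\gamma))$; (A9) $\alpha\vee(\alpha\to\beta)$;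 (A10) $\alpha\vee\neg\alpha$; (A11) $\circ\alpha\to(\alpha\to(\neg\alpha\to\beta))$; (Ax12) $\varphi[x/t]\to\exists x\varphi$ if $t$ is free for $x$ in $\varphi$; (Ax13) $\forall x\varphi\to\varphi[x/t]$ if $t$ is free for $x$ in $\varphi$; (Ax14) $\alpha\to\beta$ whenever $\alpha$ is a variant of $\beta$. Rules: (MP) from $\alpha$, $\alpha\to\beta$ infer $\beta$; ($\exists$-In) from $\varphi\to\psi$ infer $\exists x\varphi\to\psi$ if $x$ is not free in $\psi$; ($\forall$-In) from $\varphi\to\psi$ infer $\varphi\to\forall x\psi$ if $x$ is not free in $\varphi$. $\Gamma\vdash_{\mathbf{QmbC}}\varphi$ means there is a finite derivation of $\varphi$ whose steps are axiom instances, members of $\Gamma$, or follow from earlier steps by a rule. **Swap structures.** For a Boolean algebra $\mathcal A$ with domain $A$, let $B_{\mathcal A}=\{x\in A^3: x_1\vee x_2=1,\ x_1\wedge x_2\wedge x_3=0\}$, where $x_i=\pi_i(x)$ is the $i$-th coordinate. A *swap structure for mbC over $\mathcal A$* is a multialgebra $\mathcal B=(B,\tilde\wedge,\tilde\vee,\tilde\to,\tilde\neg,\tilde\circ)$ with $\emptyset\neq B\subseteq B_{\mathcal A}$ (write $|\mathcal B|=B$) such that for all $x,y\in B$: $\emptyset\ne x\tilde\# y\subseteq\{z\in B: z_1=x_1\# y_1\}$ for $\#\in\{\wedge,\vee,\to\}$; $\emptyset\neq\tilde\neg x\subseteq\{z\in B: z_1=x_2\}$; $\emptyset\ne\tilde\circ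 x\subseteq\{z\in B: z_1=x_3\}$. Its Nmatrix is $\mathcal M(\mathcal B)=(\mathcal B,D)$ with $D=\{x\in B: x_1=1\}$. **Structures and valuations.** Let $\mathcal B$ be a swap structure for mbC over a *complete* Boolean algebra. A structure $\mathfrak A=\langle U,I_{\mathfrak A}\rangle$ over $\mathcal M(\mathcal B)$ and $\Theta$ has a nonempty domain $U$ and assigns $c^{\mathfrak A}\in U$ to constants, $f^{\mathfrak A}:U^n\to U$ to $n$-ary function symbols, and $P^{\mathfrak A}:U^n\to|\mathcal B|$ to $n$-ary predicate symbols. $\Theta_U$ is $\Theta$ plus a new constant $\bar a$ for each $a\in U$; $\widehat{\mathfrak A}$ extends $\mathfrak A$ by interpreting $\bar a$ as $a$. An assignment is a map $\mu:Var\to U$; $[\![t]\!]^{\widehat{\mathfrak A}}_\mu\in U$ is the usual value of a term $t$ (the subscript is omitted for closed terms); $\widehat\mu(s)$ is obtained from a term or formula $s$ over $\Theta_U$ by replacing each free variable $x$ by $\overline{\mu(x)}$; $\mu^x_a$ is $\mu$ changed to take value $a$ at $x$. A *QmbC-valuation* over $\mathfrak A$ and $\mathcal M(\mathcal B)$ is a map $v:Sen(\Theta_U)\to|\mathcal B|$ such that: (i) $v(P(t_1,\dots,t_n))=P^{\mathfrak A}([\![t_1]\!]^{\widehat{\mathfrak A}},\dots,[\![t_n]\!]^{\widehat{\mathfrak A}})$; (ii) $v(\#\varphi)\in\tilde\# v(\varphi)$ for $\#\in\{\neg,\circ\}$; (iii) $v(\varphi\#\psi)\in v(\varphi)\tilde\#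 v(\psi)$ for $\#\in\{\wedge,\vee,\to\}$; (iv) $(v(\forall x\varphi))_1=\bigwedge_{a\in U}(v(\varphi[x/\bar a]))_1$; (v) $(v(\exists x\varphi))_1=\bigvee_{a\in U}(v(\varphi[x/\bar a]))_1$; (vi) whenever $t$ is free for $z$ in $\varphi$ and $\psi$, $\mu$ is an assignment and $b=[\![t]\!]^{\widehat{\mathfrak A}}_\mu$: (vi.1) if $v(\widehat\mu(\varphi[z/t]))=v(\widehat\mu(\varphi[z/\bar b]))$ then $v(\widehat\mu((\#\varphi)[z/t]))=v(\widehat\mu((\#\varphi)[z/\bar b]))$ for $\#\in\{\neg,\circ\}$; (vi.2) if $v(\widehat\mu(\varphi[z/t]))=v(\widehat\mu(\varphi[z/\bar b]))$ and $v(\widehat\mu(\psi[z/t]))=v(\widehat\mu(\psi[z/\bar b]))$ then $v(\widehat\mu((\varphi\#\psi)[z/t]))=v(\widehat\mu((\varphi\#\psi)[z/\bar b]))$ for $\#\in\{\wedge,\vee,\to\}$; (vi.3) if $x\ne z$, $x$ does not occur in $t$, and $v(\widehat{\mu^x_a}(\varphi[z/t]))=v(\widehat{\mu^x_a}(\varphi[z/\bar b]))$ for every $a\in U$, then $v(\widehat\mu((Qx\varphi)[z/t]))=v(\widehat\mu((Qx\varphi)[z/\bar b]))$ for $Q\in\{\forall,\exists\}$; (vii) $v(\varphi)=v(\varphi')$ if $\varphi,\varphi'$ are variants. Put $v_\mu(\varphi)=v(\widehat\mu(\varphi))$ for $\varphi\in For(\Theta_U)$. **Consequence.** $\Gamma\models_{(\mathfrak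 A,\mathcal M(\mathcal B))}\varphi$ iff for every QmbC-valuation $v$ over $\mathfrak A$ and $\mathcal M(\mathcal B)$: if $v_\mu(\gamma)\in D$ for all $\gamma\in\Gamma$ and all assignments $\mu$, then $v_\mu(\varphi)\in D$ for all $\mu$. $\Gamma\models_{\mathbf{QmbC}}\varphi$ iff $\Gamma\models_{(\mathfrak A,\mathcal M(\mathcal B))}\varphi$ for every swap structure $\mathcal B$ for mbC over a complete Boolean algebra and every structure $\mathfrak A$ over $\mathcal M(\mathcal B)$ and $\Theta$. *)

theory Defs
  imports "HOL-Algebra.Complete_Lattice" "HOL-Library.Equipollence"
begin

section \<open>Language\<close>

text \<open>
  The individual variables are the natural numbers. A signature is given by carrier sets, so that
  the sets of constants and of function symbols may be empty. Arities are at least 1: the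
  components of index 0 of \<open>sig_funs\<close> and \<open>sig_preds\<close> are never used.
\<close>

record ('c, 'f, 'p) fo_signature =
  sig_consts :: "'c set"
  sig_funs :: "nat \<Rightarrow> 'f set"
  sig_preds :: "nat \<Rightarrow> 'p set"

definition is_signature :: "('c, 'f, 'p) fo_signature \<Rightarrow> bool" where
  "is_signature \<Theta> \<longleftrightarrow> (\<exists>n\<ge>1. sig_preds \<Theta> n \<noteq> {})"

datatype binop = And | Or | Imp
datatype unop = Neg | Circ
datatype quant = Forall | Exists

datatype ('c, 'f) tm = Var nat | Const 'c | Fun 'f "('c, 'f) tm list"

datatype ('c, 'f, 'p) fm =
    Pred 'p "('c, 'f) tm list"
  | Binary binop "('c, 'f, 'p) fm" "('c, 'f, 'p) fm"
  | Unary unop "('c, 'f, 'p) fm"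
  | Quant quant nat "('c, 'f, 'p) fm"

abbreviation fm_and (infixr "\<^bold>\<and>" 65) where "\<phi> \<^bold>\<and> \<psi> \<equiv> Binary And \<phi> \<psi>"
abbreviation fm_or (infixr "\<^bold>\<or>" 60) where "\<phi> \<^bold>\<or> \<psi> \<equiv> Binary Or \<phi> \<psi>"
abbreviation fm_imp (infixr "\<^bold>\<rightarrow>" 55) where "\<phi> \<^bold>\<rightarrow> \<psi> \<equiv> Binary Imp \<phi> \<psi>"
abbreviation fm_neg ("\<^bold>\<not> _" [70] 70) where "\<^bold>\<not> \<phi> \<equiv> Unary Neg \<phi>"
abbreviation fm_circ ("\<^bold>\<circ> _" [70] 70) where "\<^bold>\<circ> \<phi> \<equiv> Unary Circ \<phi>"

fun tm_vars :: "('c, 'f) tm \<Rightarrow> nat set" where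
  "tm_vars (Var x) = {x}"
| "tm_vars (Const c) = {}"
| "tm_vars (Fun f ts) = (\<Union>t\<in>set ts. tm_vars t)"

fun fv :: "('c, 'f, 'p) fm \<Rightarrow> nat set" where
  "fv (Pred P ts) = (\<Union>t\<in>set ts. tm_vars t)"
| "fv (Binary b \<phi> \<psi>) = fv \<phi> \<union> fv \<psi>"
| "fv (Unary u \<phi>) = fv \<phi>"
| "fv (Quant Q x \<phi>) = fv \<phi> - {x}"

inductive_set Ter :: "('c, 'f, 'p) fo_signature \<Rightarrow> ('c, 'f) tm set"
  for \<Theta> :: "('c, 'f, 'p) fo_signature" where
  "Var x \<in> Ter \<Theta>"
| "c \<in> sig_consts \<Theta> \<Longrightarrow> Const c \<in> Ter \<Theta>"
| "\<lbrakk>ts \<noteq> []; f \<in> sig_funs \<Theta> (length ts); \<forall>t\<in>set ts. t \<in> Ter \<Theta>\<rbrakk> \<Longrightarrow> Fun f ts \<in> Ter \<Theta>"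

inductive_set For :: "('c, 'f, 'p) fo_signature \<Rightarrow> ('c, 'f, 'p) fm set"
  for \<Theta> :: "('c, 'f, 'p) fo_signature" where
  "\<lbrakk>ts \<noteq> []; P \<in> sig_preds \<Theta> (length ts); \<forall>t\<in>set ts. t \<in> Ter \<Theta>\<rbrakk> \<Longrightarrow> Pred P ts \<in> For \<Theta>"
| "\<lbrakk>\<phi> \<in> For \<Theta>; \<psi> \<in> For \<Theta>\<rbrakk> \<Longrightarrow> Binary b \<phi> \<psi> \<in> For \<Theta>"
| "\<phi> \<in> For \<Theta> \<Longrightarrow> Unary u \<phi> \<in> For \<Theta>"
| "\<phi> \<in> For \<Theta> \<Longrightarrow> Quant Q x \<phi> \<in> For \<Theta>"

definition CTer :: "('c, 'f, 'p) fo_signature \<Rightarrow> ('c, 'f) tm set" where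
  "CTer \<Theta> = {t \<in> Ter \<Theta>. tm_vars t = {}}"

definition Sen :: "('c, 'f, 'p) fo_signature \<Rightarrow> ('c, 'f, 'p) fm set" where
  "Sen \<Theta> = {\<phi> \<in> For \<Theta>. fv \<phi> = {}}"

text \<open>
  Simultaneous replacement of the free occurrences of all variables. Bound variables are not
  renamed, so variables may be captured; \<open>free_for\<close> is the side condition excluding this.
\<close>

fun tm_inst :: "(nat \<Rightarrow> ('c, 'f) tm) \<Rightarrow> ('c, 'f) tm \<Rightarrow> ('c, 'f) tm" where
  "tm_inst \<sigma> (Var x) = \<sigma> x"
| "tm_inst \<sigma> (Const c) = Const c"
| "tm_inst \<sigma> (Fun f ts) = Fun f (map (tm_inst \<sigma>) ts)"

fun fm_inst :: "(nat \<Rightarrow> ('c, 'f) tm) \<Rightarrow> ('c, 'f, 'p) fm \<Rightarrow> ('c, 'f, 'p) fm" where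
  "fm_inst \<sigma> (Pred P ts) = Pred P (map (tm_inst \<sigma>) ts)"
| "fm_inst \<sigma> (Binary b \<phi> \<psi>) = Binary b (fm_inst \<sigma> \<phi>) (fm_inst \<sigma> \<psi>)"
| "fm_inst \<sigma> (Unary u \<phi>) = Unary u (fm_inst \<sigma> \<phi>)"
| "fm_inst \<sigma> (Quant Q x \<phi>) = Quant Q x (fm_inst (\<sigma>(x := Var x)) \<phi>)"

definition subst :: "('c, 'f, 'p) fm \<Rightarrow> nat \<Rightarrow> ('c, 'f) tm \<Rightarrow> ('c, 'f, 'p) fm"
    ("_[_'/'/_]" [1000, 0, 0] 1000) where
  "\<phi>[x//t] = fm_inst (Var(x := t)) \<phi>"

text \<open>\<open>free_for t x \<phi>\<close>: no free occurrence of \<open>x\<close> in \<open>\<phi>\<close> lies in the scope of a quantifier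
  binding a variable of \<open>t\<close>.\<close>

fun free_for :: "('c, 'f) tm \<Rightarrow> nat \<Rightarrow> ('c, 'f, 'p) fm \<Rightarrow> bool" where
  "free_for t x (Pred P ts) \<longleftrightarrow> True"
| "free_for t x (Binary b \<phi> \<psi>) \<longleftrightarrow> free_for t x \<phi> \<and> free_for t x \<psi>"
| "free_for t x (Unary u \<phi>) \<longleftrightarrow> free_for t x \<phi>"
| "free_for t x (Quant Q y \<phi>) \<longleftrightarrow> x \<notin> fv (Quant Q y \<phi>) \<or> y \<notin> tm_vars t \<and> free_for t x \<phi>"

text \<open>Void quantifiers and bound variables may be changed anywhere in the formula, and
  repeatedly: \<open>variant\<close> is the least congruence generated by the two basic changes.\<close>

inductive variant :: "('c, 'f, 'p) fm \<Rightarrow> ('c, 'f, 'p) fm \<Rightarrow> bool" where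
  void: "x \<notin> fv \<phi> \<Longrightarrow> variant (Quant Q x \<phi>) \<phi>"
| rename: "\<lbrakk>y \<notin> fv \<phi>; free_for (Var y) x \<phi>\<rbrakk> \<Longrightarrow> variant (Quant Q x \<phi>) (Quant Q y (\<phi>[x//Var y]))"
| refl: "variant \<phi> \<phi>"
| sym: "variant \<phi> \<psi> \<Longrightarrow> variant \<psi> \<phi>"
| trans: "\<lbrakk>variant \<phi> \<psi>; variant \<psi> \<chi>\<rbrakk> \<Longrightarrow> variant \<phi> \<chi>"
| Binary: "\<lbrakk>variant \<phi> \<phi>'; variant \<psi> \<psi>'\<rbrakk> \<Longrightarrow> variant (Binary b \<phi> \<psi>) (Binary b \<phi>' \<psi>')"
| Unary: "variant \<phi> \<phi>' \<Longrightarrow> variant (Unary u \<phi>) (Unary u \<phi>')"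
| Quant: "variant \<phi> \<phi>' \<Longrightarrow> variant (Quant Q x \<phi>) (Quant Q x \<phi>')"


section \<open>The calculus QmbC\<close>

inductive qmbc_axiom :: "('c, 'f, 'p) fm \<Rightarrow> bool" where
  A1: "qmbc_axiom (\<alpha> \<^bold>\<rightarrow> (\<beta> \<^bold>\<rightarrow> \<alpha>))"
| A2: "qmbc_axiom ((\<alpha> \<^bold>\<rightarrow> (\<beta> \<^bold>\<rightarrow> \<gamma>)) \<^bold>\<rightarrow> ((\<alpha> \<^bold>\<rightarrow> \<beta>) \<^bold>\<rightarrow> (\<alpha> \<^bold>\<rightarrow> \<gamma>)))"
| A3: "qmbc_axiom (\<alpha> \<^bold>\<rightarrow> (\<beta> \<^bold>\<rightarrow> (\<alpha> \<^bold>\<and> \<beta>)))"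
| A4: "qmbc_axiom ((\<alpha> \<^bold>\<and> \<beta>) \<^bold>\<rightarrow> \<alpha>)"
| A5: "qmbc_axiom ((\<alpha> \<^bold>\<and> \<beta>) \<^bold>\<rightarrow> \<beta>)"
| A6: "qmbc_axiom (\<alpha> \<^bold>\<rightarrow> (\<alpha> \<^bold>\<or> \<beta>))"
| A7: "qmbc_axiom (\<beta> \<^bold>\<rightarrow> (\<alpha> \<^bold>\<or> \<beta>))"
| A8: "qmbc_axiom ((\<alpha> \<^bold>\<rightarrow> \<gamma>) \<^bold>\<rightarrow> ((\<beta> \<^bold>\<rightarrow> \<gamma>) \<^bold>\<rightarrow> ((\<alpha> \<^bold>\<or> \<beta>) \<^bold>\<rightarrow> \<gamma>)))"
| A9: "qmbc_axiom (\<alpha> \<^bold>\<or> (\<alpha> \<^bold>\<rightarrow> \<beta>))"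
| A10: "qmbc_axiom (\<alpha> \<^bold>\<or> (\<^bold>\<not> \<alpha>))"
| A11: "qmbc_axiom ((\<^bold>\<circ> \<alpha>) \<^bold>\<rightarrow> (\<alpha> \<^bold>\<rightarrow> ((\<^bold>\<not> \<alpha>) \<^bold>\<rightarrow> \<beta>)))"
| Ax12: "free_for t x \<phi> \<Longrightarrow> qmbc_axiom (\<phi>[x//t] \<^bold>\<rightarrow> Quant Exists x \<phi>)"
| Ax13: "free_for t x \<phi> \<Longrightarrow> qmbc_axiom (Quant Forall x \<phi> \<^bold>\<rightarrow> \<phi>[x//t])"
| Ax14: "variant \<alpha> \<beta> \<Longrightarrow> qmbc_axiom (\<alpha> \<^bold>\<rightarrow> \<beta>)"

inductive qmbc_derivable ::
    "('c, 'f, 'p) fo_signature \<Rightarrow> ('c, 'f, 'p) fm set \<Rightarrow> ('c, 'f, 'p) fm \<Rightarrow> bool"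
  for \<Theta> :: "('c, 'f, 'p) fo_signature" and \<Gamma> :: "('c, 'f, 'p) fm set" where
  Axiom: "\<lbrakk>qmbc_axiom \<phi>; \<phi> \<in> For \<Theta>\<rbrakk> \<Longrightarrow> qmbc_derivable \<Theta> \<Gamma> \<phi>"
| Premise: "\<phi> \<in> \<Gamma> \<Longrightarrow> qmbc_derivable \<Theta> \<Gamma> \<phi>"
| MP: "\<lbrakk>qmbc_derivable \<Theta> \<Gamma> \<alpha>; qmbc_derivable \<Theta> \<Gamma> (\<alpha> \<^bold>\<rightarrow> \<beta>)\<rbrakk> \<Longrightarrow> qmbc_derivable \<Theta> \<Gamma> \<beta>"
| Ex_In: "\<lbrakk>qmbc_derivable \<Theta> \<Gamma> (\<phi> \<^bold>\<rightarrow> \<psi>); x \<notin> fv \<psi>\<rbrakk> \<Longrightarrow> qmbc_derivable \<Theta> \<Gamma> (Quant Exists x \<phi> \<^bold>\<rightarrow> \<psi>)"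
| All_In: "\<lbrakk>qmbc_derivable \<Theta> \<Gamma> (\<phi> \<^bold>\<rightarrow> \<psi>); x \<notin> fv \<phi>\<rbrakk> \<Longrightarrow> qmbc_derivable \<Theta> \<Gamma> (\<phi> \<^bold>\<rightarrow> Quant Forall x \<psi>)"


section \<open>Boolean algebras and swap structures\<close>

text \<open>The one-element algebra is not excluded. (Every snapshot over it is designated, so it does
  not affect the consequence relation.)\<close>

locale boolean_lattice = bounded_lattice L for L (structure) +
  assumes meet_join_distrib:
    "\<lbrakk>x \<in> carrier L; y \<in> carrier L; z \<in> carrier L\<rbrakk> \<Longrightarrow> x \<sqinter> (y \<squnion> z) = (x \<sqinter> y) \<squnion> (x \<sqinter> z)"
    and complement_exists:
    "x \<in> carrier L \<Longrightarrow> \<exists>y\<in>carrier L. x \<sqinter> y = \<bottom> \<and> x \<squnion> y = \<top>"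

locale complete_boolean_lattice = complete_lattice L + boolean_lattice L for L (structure)

definition ba_compl :: "'a gorder \<Rightarrow> 'a \<Rightarrow> 'a" where
  "ba_compl L x = (THE y. y \<in> carrier L \<and> x \<sqinter>\<^bsub>L\<^esub> y = \<bottom>\<^bsub>L\<^esub> \<and> x \<squnion>\<^bsub>L\<^esub> y = \<top>\<^bsub>L\<^esub>)"

fun ba_op :: "'a gorder \<Rightarrow> binop \<Rightarrow> 'a \<Rightarrow> 'a \<Rightarrow> 'a" where
  "ba_op L And x y = x \<sqinter>\<^bsub>L\<^esub> y"
| "ba_op L Or x y = x \<squnion>\<^bsub>L\<^esub> y"
| "ba_op L Imp x y = ba_compl L x \<squnion>\<^bsub>L\<^esub> y"

type_synonym 'a snapshot = "'a \<times> 'a \<times> 'a"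

definition pr1 :: "'a snapshot \<Rightarrow> 'a" where "pr1 z = fst z"
definition pr2 :: "'a snapshot \<Rightarrow> 'a" where "pr2 z = fst (snd z)"
definition pr3 :: "'a snapshot \<Rightarrow> 'a" where "pr3 z = snd (snd z)"

definition snapshots :: "'a gorder \<Rightarrow> 'a snapshot set" where
  "snapshots L = {z. pr1 z \<in> carrier L \<and> pr2 z \<in> carrier L \<and> pr3 z \<in> carrier L \<and>
     pr1 z \<squnion>\<^bsub>L\<^esub> pr2 z = \<top>\<^bsub>L\<^esub> \<and> pr1 z \<sqinter>\<^bsub>L\<^esub> pr2 z \<sqinter>\<^bsub>L\<^esub> pr3 z = \<bottom>\<^bsub>L\<^esub>}"

record 'a multialgebra =
  msnap :: "'a snapshot set"
  mbin :: "binop \<Rightarrow> 'a snapshot \<Rightarrow> 'a snapshot \<Rightarrow> 'a snapshot set"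
  mun :: "unop \<Rightarrow> 'a snapshot \<Rightarrow> 'a snapshot set"

locale swap_structure = boolean_lattice L for L :: "'a gorder" (structure) +
  fixes \<B> :: "'a multialgebra"
  assumes swap_nonempty: "msnap \<B> \<noteq> {}"
    and swap_subset: "msnap \<B> \<subseteq> snapshots L"
    and swap_bin: "\<lbrakk>x \<in> msnap \<B>; y \<in> msnap \<B>\<rbrakk> \<Longrightarrow>
      mbin \<B> b x y \<noteq> {} \<and> mbin \<B> b x y \<subseteq> {z \<in> msnap \<B>. pr1 z = ba_op L b (pr1 x) (pr1 y)}"
    and swap_neg: "x \<in> msnap \<B> \<Longrightarrow> mun \<B> Neg x \<noteq> {} \<and> mun \<B> Neg x \<subseteq> {z \<in> msnap \<B>. pr1 z = pr2 x}"
    and swap_circ: "x \<in> msnap \<B> \<Longrightarrow> mun \<B> Circ x \<noteq> {} \<and> mun \<B> Circ x \<subseteq> {z \<in> msnap \<B>. pr1 z = pr3 x}"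

definition designated :: "'a gorder \<Rightarrow> 'a multialgebra \<Rightarrow> 'a snapshot set" where
  "designated L \<B> = {z \<in> msnap \<B>. pr1 z = \<top>\<^bsub>L\<^esub>}"


section \<open>First-order structures and valuations\<close>

record ('c, 'f, 'p, 'u, 'a) fo_structure =
  udom :: "'u set"
  iconst :: "'c \<Rightarrow> 'u"
  ifun :: "'f \<Rightarrow> 'u list \<Rightarrow> 'u"
  ipred :: "'p \<Rightarrow> 'u list \<Rightarrow> 'a snapshot"

definition is_structure ::
    "('c, 'f, 'p) fo_signature \<Rightarrow> 'a multialgebra \<Rightarrow> ('c, 'f, 'p, 'u, 'a) fo_structure \<Rightarrow> bool" where
  "is_structure \<Theta> \<B> \<AA> \<longleftrightarrow>
     udom \<AA> \<noteq> {} \<and>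
     (\<forall>c\<in>sig_consts \<Theta>. iconst \<AA> c \<in> udom \<AA>) \<and>
     (\<forall>n\<ge>1. \<forall>f\<in>sig_funs \<Theta> n. \<forall>us\<in>lists (udom \<AA>). length us = n \<longrightarrow> ifun \<AA> f us \<in> udom \<AA>) \<and>
     (\<forall>n\<ge>1. \<forall>P\<in>sig_preds \<Theta> n. \<forall>us\<in>lists (udom \<AA>). length us = n \<longrightarrow> ipred \<AA> P us \<in> msnap \<B>)"

text \<open>In the diagram language the constants of the original signature are tagged by \<open>Inl\<close>, and
  \<open>Inr a\<close> is the new constant naming the element \<open>a\<close> of the domain.\<close>

definition diag_sig ::
    "('c, 'f, 'p) fo_signature \<Rightarrow> ('c, 'f, 'p, 'u, 'a) fo_structure \<Rightarrow> ('c + 'u, 'f, 'p) fo_signature" where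
  "diag_sig \<Theta> \<AA> = \<lparr>sig_consts = Inl ` sig_consts \<Theta> \<union> Inr ` udom \<AA>,
     sig_funs = sig_funs \<Theta>, sig_preds = sig_preds \<Theta>\<rparr>"

definition diag_structure ::
    "('c, 'f, 'p, 'u, 'a) fo_structure \<Rightarrow> ('c + 'u, 'f, 'p, 'u, 'a) fo_structure" where
  "diag_structure \<AA> = \<lparr>udom = udom \<AA>, iconst = case_sum (iconst \<AA>) (\<lambda>a. a),
     ifun = ifun \<AA>, ipred = ipred \<AA>\<rparr>"

abbreviation name_of :: "'u \<Rightarrow> ('c + 'u, 'f) tm" where
  "name_of a \<equiv> Const (Inr a)"

definition assignment :: "('c, 'f, 'p, 'u, 'a) fo_structure \<Rightarrow> (nat \<Rightarrow> 'u) \<Rightarrow> bool" where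
  "assignment \<AA> \<mu> \<longleftrightarrow> range \<mu> \<subseteq> udom \<AA>"

fun tm_val :: "('c, 'f, 'p, 'u, 'a) fo_structure \<Rightarrow> (nat \<Rightarrow> 'u) \<Rightarrow> ('c, 'f) tm \<Rightarrow> 'u" where
  "tm_val \<AA> \<mu> (Var x) = \<mu> x"
| "tm_val \<AA> \<mu> (Const c) = iconst \<AA> c"
| "tm_val \<AA> \<mu> (Fun f ts) = ifun \<AA> f (map (tm_val \<AA> \<mu>) ts)"

abbreviation diag_val ::
    "('c, 'f, 'p, 'u, 'a) fo_structure \<Rightarrow> (nat \<Rightarrow> 'u) \<Rightarrow> ('c + 'u, 'f) tm \<Rightarrow> 'u" where
  "diag_val \<AA> \<equiv> tm_val (diag_structure \<AA>)"

definition ground :: "(nat \<Rightarrow> 'u) \<Rightarrow> ('c + 'u, 'f, 'p) fm \<Rightarrow> ('c + 'u, 'f, 'p) fm" where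
  "ground \<mu> \<phi> = fm_inst (\<lambda>x. name_of (\<mu> x)) \<phi>"

text \<open>A valuation is a total function in HOL, but only its values on the sentences of the diagram
  language are relevant. In \<open>v_pred\<close> the terms are closed, so the assignment is immaterial.\<close>

locale qmbc_valuation =
  fixes \<Theta> :: "('c, 'f, 'p) fo_signature"
    and L :: "'a gorder"
    and \<B> :: "'a multialgebra"
    and \<AA> :: "('c, 'f, 'p, 'u, 'a) fo_structure"
    and v :: "('c + 'u, 'f, 'p) fm \<Rightarrow> 'a snapshot"
  assumes v_type: "\<phi> \<in> Sen (diag_sig \<Theta> \<AA>) \<Longrightarrow> v \<phi> \<in> msnap \<B>"
    and v_pred: "\<lbrakk>ts \<noteq> []; P \<in> sig_preds \<Theta> (length ts); set ts \<subseteq> CTer (diag_sig \<Theta> \<AA>);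
      assignment \<AA> \<mu>\<rbrakk> \<Longrightarrow>
      v (Pred P ts) = ipred \<AA> P (map (diag_val \<AA> \<mu>) ts)"
    and v_un: "\<phi> \<in> Sen (diag_sig \<Theta> \<AA>) \<Longrightarrow> v (Unary uop \<phi>) \<in> mun \<B> uop (v \<phi>)"
    and v_bin: "\<lbrakk>\<phi> \<in> Sen (diag_sig \<Theta> \<AA>); \<psi> \<in> Sen (diag_sig \<Theta> \<AA>)\<rbrakk> \<Longrightarrow>
      v (Binary bop \<phi> \<psi>) \<in> mbin \<B> bop (v \<phi>) (v \<psi>)"
    and v_all: "Quant Forall x \<phi> \<in> Sen (diag_sig \<Theta> \<AA>) \<Longrightarrow>
      pr1 (v (Quant Forall x \<phi>)) = \<Sqinter>\<^bsub>L\<^esub> {pr1 (v (\<phi>[x//name_of a])) |a. a \<in> udom \<AA>}"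
    and v_ex: "Quant Exists x \<phi> \<in> Sen (diag_sig \<Theta> \<AA>) \<Longrightarrow>
      pr1 (v (Quant Exists x \<phi>)) = \<Squnion>\<^bsub>L\<^esub> {pr1 (v (\<phi>[x//name_of a])) |a. a \<in> udom \<AA>}"
    and v_subst_un: "\<lbrakk>\<phi> \<in> For (diag_sig \<Theta> \<AA>); t \<in> Ter (diag_sig \<Theta> \<AA>); free_for t z \<phi>;
      assignment \<AA> \<mu>; b = diag_val \<AA> \<mu> t;
      v (ground \<mu> (\<phi>[z//t])) = v (ground \<mu> (\<phi>[z//name_of b]))\<rbrakk> \<Longrightarrow>
      v (ground \<mu> ((Unary uop \<phi>)[z//t])) = v (ground \<mu> ((Unary uop \<phi>)[z//name_of b]))"
    and v_subst_bin: "\<lbrakk>\<phi> \<in> For (diag_sig \<Theta> \<AA>); \<psi> \<in> For (diag_sig \<Theta> \<AA>); t \<in> Ter (diag_sig \<Theta> \<AA>);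
      free_for t z \<phi>; free_for t z \<psi>;
      assignment \<AA> \<mu>; b = diag_val \<AA> \<mu> t;
      v (ground \<mu> (\<phi>[z//t])) = v (ground \<mu> (\<phi>[z//name_of b]));
      v (ground \<mu> (\<psi>[z//t])) = v (ground \<mu> (\<psi>[z//name_of b]))\<rbrakk> \<Longrightarrow>
      v (ground \<mu> ((Binary bop \<phi> \<psi>)[z//t])) = v (ground \<mu> ((Binary bop \<phi> \<psi>)[z//name_of b]))"
    and v_subst_qu: "\<lbrakk>\<phi> \<in> For (diag_sig \<Theta> \<AA>); t \<in> Ter (diag_sig \<Theta> \<AA>); free_for t z \<phi>;
      assignment \<AA> \<mu>; b = diag_val \<AA> \<mu> t;
      x \<noteq> z; x \<notin> tm_vars t;
      \<forall>a\<in>udom \<AA>. v (ground (\<mu>(x := a)) (\<phi>[z//t])) = v (ground (\<mu>(x := a)) (\<phi>[z//name_of b]))\<rbrakk> \<Longrightarrow>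
      v (ground \<mu> ((Quant Q x \<phi>)[z//t])) = v (ground \<mu> ((Quant Q x \<phi>)[z//name_of b]))"
    and v_variant: "\<lbrakk>\<phi> \<in> Sen (diag_sig \<Theta> \<AA>); \<phi>' \<in> Sen (diag_sig \<Theta> \<AA>); variant \<phi> \<phi>'\<rbrakk> \<Longrightarrow> v \<phi> = v \<phi>'"


section \<open>Semantical consequence\<close>

definition lift_fm :: "('c, 'f, 'p) fm \<Rightarrow> ('c + 'u, 'f, 'p) fm" where
  "lift_fm = map_fm Inl (\<lambda>f. f) (\<lambda>P. P)"

definition conseq_in ::
    "('c, 'f, 'p) fo_signature \<Rightarrow> 'a gorder \<Rightarrow> 'a multialgebra \<Rightarrow> ('c, 'f, 'p, 'u, 'a) fo_structure \<Rightarrow>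
     ('c, 'f, 'p) fm set \<Rightarrow> ('c, 'f, 'p) fm \<Rightarrow> bool" where
  "conseq_in \<Theta> L \<B> \<AA> \<Gamma> \<phi> \<longleftrightarrow>
     (\<forall>v. qmbc_valuation \<Theta> L \<B> \<AA> v \<longrightarrow>
        (\<forall>\<gamma>\<in>\<Gamma>. \<forall>\<mu>. assignment \<AA> \<mu> \<longrightarrow> v (ground \<mu> (lift_fm \<gamma>)) \<in> designated L \<B>) \<longrightarrow>
        (\<forall>\<mu>. assignment \<AA> \<mu> \<longrightarrow> v (ground \<mu> (lift_fm \<phi>)) \<in> designated L \<B>))"

text \<open>
  HOL cannot quantify over types inside a formula, so the types \<open>'a\<close> and \<open>'u\<close> in which the Boolean
  algebras and the domains live are parameters. Both are types of raw elements: the carriers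
  and the domains themselves are arbitrary subsets. A consequence over all algebras and domains is
  one over every choice of \<open>'a\<close> and \<open>'u\<close>; for completeness it is enough to have one \<open>'a\<close>
  with two elements and one \<open>'u\<close> no smaller than the set of formulas.
\<close>

definition qmbc_conseq ::
    "'a itself \<Rightarrow> 'u itself \<Rightarrow> ('c, 'f, 'p) fo_signature \<Rightarrow> ('c, 'f, 'p) fm set \<Rightarrow> ('c, 'f, 'p) fm \<Rightarrow> bool"
  where
  "qmbc_conseq _ _ \<Theta> \<Gamma> \<phi> \<longleftrightarrow>
     (\<forall>(L :: 'a gorder) (\<B> :: 'a multialgebra) (\<AA> :: ('c, 'f, 'p, 'u, 'a) fo_structure).
        complete_boolean_lattice L \<longrightarrow> swap_structure L \<B> \<longrightarrow> is_structure \<Theta> \<B> \<AA> \<longrightarrow>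
        conseq_in \<Theta> L \<B> \<AA> \<Gamma> \<phi>)"

end

(*
  A Henkin construction. If phi is not derivable from Gamma, neither is its universal closure.
  Witness constants are added to the language and the resulting theory is extended to one that
  is maximal among those not deriving the closure. It then behaves classically on the positive
  connectives and quantifiers. The closed terms of the Henkin language form the domain, the
  Boolean algebra is the two-element one, and a sentence alpha is sent to the snapshot of
  the truth values of (alpha, not alpha, circ alpha) in the theory; (A10) and (A11) say that this
  is a snapshot. The name of a domain element is read as that very closed term, so replacing a
  term by the name of its value does not change the translated sentence, and condition (vi) holds
  trivially.
*)

theory Submission
  imports Defs
begin

text \<open>The negation of QmbC offers no reductio. Its role is taken by (A9),
  \<open>\<alpha> \<or> (\<alpha> \<rightarrow> \<beta>)\<close>: an implication
  \<open>\<alpha> \<rightarrow> \<phi>\<close> into the underivable formula does duty as the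
  refutation of \<open>\<alpha>\<close>. The quantifier rules act on premises with free variables,
  so the deduction theorem discharges sentences only; hence both the witness axioms and the formulas
  added by maximality are sentences. A witness axiom is discharged and its constant turned into a
  variable fresh for the whole derivation. This works for an axiom whose constant occurs nowhere
  else, which fixes the order of elimination. The domain has to live in the given type
  \<open>'u\<close>, which is only assumed to have room for the formulas of \<open>\<Theta>\<close>.
  Witness constants contain formulas that contain witness constants, so the Henkin terms must be
  counted: coding them injectively by formulas of \<open>\<Theta>\<close> gives the map
  \<open>e\<close> from closed terms into \<open>'u\<close>. The values of
  \<open>\<not>\<alpha>\<close> and \<open>\<circ>\<alpha>\<close> are not determined by that of
  \<open>\<alpha>\<close>; a swap structure that permits every admissible output accommodates
  whatever the theory decides.\<close>

section \<open>Substitution\<close>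

fun fm_bv :: "('c, 'f, 'p) fm \<Rightarrow> nat set" where
  "fm_bv (Pred P ts) = {}"
| "fm_bv (Binary b \<phi> \<psi>) = fm_bv \<phi> \<union> fm_bv \<psi>"
| "fm_bv (Unary u \<phi>) = fm_bv \<phi>"
| "fm_bv (Quant Q x \<phi>) = insert x (fm_bv \<phi>)"

lemma finite_fm_bv [simp]: "finite (fm_bv \<phi>)"
  by (induction \<phi>) auto

lemma finite_tm_vars [simp]: "finite (tm_vars t)"
  by (induction t) auto

lemma finite_fv [simp]: "finite (fv \<phi>)"
  by (induction \<phi>) auto

lemma Ter_simps [simp]:
  "Var x \<in> Ter \<Theta>"
  "Const c \<in> Ter \<Theta> \<longleftrightarrow> c \<in> sig_consts \<Theta>"
  "Fun f ts \<in> Ter \<Theta> \<longleftrightarrow> ts \<noteq> [] \<and> f \<in> sig_funs \<Theta> (length ts) \<and> set ts \<subseteq> Ter \<Theta>"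
  by (auto intro: Ter.intros elim: Ter.cases)

lemma For_simps [simp]:
  "Pred P ts \<in> For \<Theta> \<longleftrightarrow> ts \<noteq> [] \<and> P \<in> sig_preds \<Theta> (length ts) \<and> set ts \<subseteq> Ter \<Theta>"
  "Binary b \<phi> \<psi> \<in> For \<Theta> \<longleftrightarrow> \<phi> \<in> For \<Theta> \<and> \<psi> \<in> For \<Theta>"
  "Unary u \<phi> \<in> For \<Theta> \<longleftrightarrow> \<phi> \<in> For \<Theta>"
  "Quant Q x \<phi> \<in> For \<Theta> \<longleftrightarrow> \<phi> \<in> For \<Theta>"
  by (auto intro: For.intros elim: For.cases)

lemma tm_inst_cong: "(\<And>x. x \<in> tm_vars t \<Longrightarrow> \<sigma> x = \<tau> x) \<Longrightarrow> tm_inst \<sigma> t = tm_inst \<tau> t"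
  by (induction t) auto

lemma fm_inst_cong: "(\<And>x. x \<in> fv \<phi> \<Longrightarrow> \<sigma> x = \<tau> x) \<Longrightarrow> fm_inst \<sigma> \<phi> = fm_inst \<tau> \<phi>"
proof (induction \<phi> arbitrary: \<sigma> \<tau>)
  case (Pred P ts)
  then have "tm_inst \<sigma> t = tm_inst \<tau> t" if "t \<in> set ts" for t
    using that by (intro tm_inst_cong) auto
  then show ?case by simp
next
  case (Binary b \<phi> \<psi>)
  from Binary.prems have "fm_inst \<sigma> \<phi> = fm_inst \<tau> \<phi>" "fm_inst \<sigma> \<psi> = fm_inst \<tau> \<psi>"
    by (rule Binary.IH, simp)+
  then show ?case by simp
next
  case (Unary u \<phi>)
  from Unary.prems have "fm_inst \<sigma> \<phi> = fm_inst \<tau> \<phi>"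
    by (rule Unary.IH) simp
  then show ?case by simp
next
  case (Quant Q x \<phi>)
  from Quant.prems have "fm_inst (\<sigma>(x := Var x)) \<phi> = fm_inst (\<tau>(x := Var x)) \<phi>"
    by (intro Quant.IH) simp
  then show ?case by simp
qed

lemma tm_inst_Var [simp]: "tm_inst Var t = t"
  by (induction t) (auto intro: map_idI)

lemma fm_inst_Var [simp]: "fm_inst Var \<phi> = \<phi>"
  by (induction \<phi>) (auto intro: map_idI)

lemma fm_inst_ident: "(\<And>x. x \<in> fv \<phi> \<Longrightarrow> \<sigma> x = Var x) \<Longrightarrow> fm_inst \<sigma> \<phi> = \<phi>"
  using fm_inst_cong[of \<phi> \<sigma> Var] by simp

lemma tm_inst_ident: "(\<And>x. x \<in> tm_vars t \<Longrightarrow> \<sigma> x = Var x) \<Longrightarrow> tm_inst \<sigma> t = t"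
  using tm_inst_cong[of t \<sigma> Var] by simp

lemma tm_inst_Ter: "t \<in> Ter \<Theta> \<Longrightarrow> (\<And>x. \<sigma> x \<in> Ter \<Theta>) \<Longrightarrow> tm_inst \<sigma> t \<in> Ter \<Theta>"
  by (induction t) auto

lemma fm_inst_For: "\<phi> \<in> For \<Theta> \<Longrightarrow> (\<And>x. \<sigma> x \<in> Ter \<Theta>) \<Longrightarrow> fm_inst \<sigma> \<phi> \<in> For \<Theta>"
proof (induction \<phi> arbitrary: \<sigma>)
  case (Pred P ts)
  then show ?case by (auto intro!: tm_inst_Ter)
qed auto

lemma subst_For: "\<phi> \<in> For \<Theta> \<Longrightarrow> t \<in> Ter \<Theta> \<Longrightarrow> \<phi>[x//t] \<in> For \<Theta>"
  by (simp add: subst_def fm_inst_For)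

lemma tm_vars_inst: "tm_vars (tm_inst \<sigma> t) = (\<Union>x\<in>tm_vars t. tm_vars (\<sigma> x))"
  by (induction t) auto

text \<open>Only an inclusion: instantiation does not rename bound variables, so a variable of
  \<open>\<sigma> x\<close> may be captured.\<close>

lemma fv_inst_subset: "fv (fm_inst \<sigma> \<phi>) \<subseteq> (\<Union>x\<in>fv \<phi>. tm_vars (\<sigma> x))"
proof (induction \<phi> arbitrary: \<sigma>)
  case (Pred P ts)
  then show ?case by (auto simp: tm_vars_inst)
next
  case (Quant Q x \<phi>)
  show ?case using Quant.IH[of "\<sigma>(x := Var x)"] by (fastforce split: if_splits simp del: fun_upd_apply simp: fun_upd_def)
next
  case (Binary b \<phi> \<psi>)
  show ?case using Binary.IH[of \<sigma>] by auto
qed auto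

lemma free_for_fresh: "tm_vars t \<inter> fm_bv \<phi> = {} \<Longrightarrow> free_for t x \<phi>"
  by (induction \<phi>) auto

lemma free_for_closed: "tm_vars t = {} \<Longrightarrow> free_for t x \<phi>"
  by (simp add: free_for_fresh)

lemma free_for_self: "free_for (Var x) x \<phi>"
  by (induction \<phi>) auto

lemma subst_self [simp]: "\<phi>[x//Var x] = \<phi>"
  by (simp add: subst_def)

lemma tm_inst_tm_inst: "tm_inst \<tau> (tm_inst \<sigma> t) = tm_inst (\<lambda>x. tm_inst \<tau> (\<sigma> x)) t"
  by (induction t) auto

text \<open>The values of \<open>\<tau>\<close> may suffer capture, but at the same places on both
  sides. What \<open>free_for\<close> secures is that resetting \<open>\<tau>\<close> at a bound
  variable above a free \<open>z\<close> leaves the value of \<open>t\<close> alone.\<close>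

lemma fm_inst_subst:
  "free_for t z \<phi> \<Longrightarrow> fm_inst \<tau> (\<phi>[z//t]) = fm_inst (\<tau>(z := tm_inst \<tau> t)) \<phi>"
proof (induction \<phi> arbitrary: \<tau>)
  case (Pred P ts)
  show ?case by (auto simp: subst_def tm_inst_tm_inst intro!: tm_inst_cong)
next
  case (Quant Q y \<phi>)
  show ?case
  proof (cases "z \<in> fv (Quant Q y \<phi>)")
    case True
    then have *: "z \<noteq> y" "y \<notin> tm_vars t" "free_for t z \<phi>" using Quant.prems by auto
    then have "tm_inst (\<tau>(y := Var y)) t = tm_inst \<tau> t"
      by (auto intro: tm_inst_cong)
    moreover have "(Quant Q y \<phi>)[z//t] = Quant Q y (\<phi>[z//t])"
      using *(1) by (simp add: subst_def fun_upd_idem)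
    ultimately show ?thesis
      using * Quant.IH[of "\<tau>(y := Var y)"] by (simp add: fun_upd_twist del: fun_upd_apply)
  next
    case False
    then have "(Quant Q y \<phi>)[z//t] = Quant Q y \<phi>"
      unfolding subst_def by (intro fm_inst_ident) auto
    moreover have "fm_inst (\<tau>(z := tm_inst \<tau> t)) (Quant Q y \<phi>) = fm_inst \<tau> (Quant Q y \<phi>)"
      using False by (intro fm_inst_cong) auto
    ultimately show ?thesis by (metis)
  qed
qed (auto simp: subst_def)

text \<open>A closed term offers nothing to capture, and resetting \<open>\<tau>\<close> at a bound
  variable does not change what \<open>\<tau>\<close> makes of it; so the two instantiations compose
  without any condition on \<open>\<phi>\<close>.\<close>

lemma fm_inst_inst:
  assumes "\<And>y. \<sigma> y = Var y \<or> tm_vars (\<sigma> y) = {}"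
  shows "fm_inst \<tau> (fm_inst \<sigma> \<phi>) = fm_inst (\<lambda>y. tm_inst \<tau> (\<sigma> y)) \<phi>"
  using assms
proof (induction \<phi> arbitrary: \<sigma> \<tau>)
  case (Quant Q x \<phi>)
  have "tm_inst (\<tau>(x := Var x)) ((\<sigma>(x := Var x)) y) = ((\<lambda>y. tm_inst \<tau> (\<sigma> y))(x := Var x)) y" for y
  proof (cases "y = x")
    case False
    then show ?thesis using Quant.prems[of y] by (auto intro: tm_inst_cong)
  qed simp
  moreover have "fm_inst (\<tau>(x := Var x)) (fm_inst (\<sigma>(x := Var x)) \<phi>) =
      fm_inst (\<lambda>y. tm_inst (\<tau>(x := Var x)) ((\<sigma>(x := Var x)) y)) \<phi>"
    using Quant.prems by (intro Quant.IH) auto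
  ultimately show ?case by (simp del: fun_upd_apply)
qed (auto simp: tm_inst_tm_inst)

text \<open>For peeling one quantifier off a closed instance: the left side is the body of the
  instantiated quantification, taken at \<open>t\<close>.\<close>

lemma subst_inst_closed:
  assumes "\<And>y. tm_vars (\<sigma> y) = {}"
  shows "(fm_inst (\<sigma>(x := Var x)) \<phi>)[x//t] = fm_inst (\<sigma>(x := t)) \<phi>"
proof -
  have "(\<lambda>y. tm_inst (Var(x := t)) ((\<sigma>(x := Var x)) y)) = \<sigma>(x := t)"
    using assms by (intro ext) (auto intro: tm_inst_ident)
  then show ?thesis using assms
    by (subst (1) subst_def, subst fm_inst_inst) auto
qed


section \<open>Replacing constants by terms\<close>

text \<open>One operation serves three purposes: passing to a language with other constants, turning
  a constant into a variable, and reading the name of a domain element as a closed term.\<close>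

fun tm_csub :: "('k \<Rightarrow> ('c, 'f) tm) \<Rightarrow> ('k, 'f) tm \<Rightarrow> ('c, 'f) tm" where
  "tm_csub \<kappa> (Var x) = Var x"
| "tm_csub \<kappa> (Const c) = \<kappa> c"
| "tm_csub \<kappa> (Fun f ts) = Fun f (map (tm_csub \<kappa>) ts)"

fun fm_csub :: "('k \<Rightarrow> ('c, 'f) tm) \<Rightarrow> ('k, 'f, 'p) fm \<Rightarrow> ('c, 'f, 'p) fm" where
  "fm_csub \<kappa> (Pred P ts) = Pred P (map (tm_csub \<kappa>) ts)"
| "fm_csub \<kappa> (Binary b \<phi> \<psi>) = Binary b (fm_csub \<kappa> \<phi>) (fm_csub \<kappa> \<psi>)"
| "fm_csub \<kappa> (Unary u \<phi>) = Unary u (fm_csub \<kappa> \<phi>)"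
| "fm_csub \<kappa> (Quant Q x \<phi>) = Quant Q x (fm_csub \<kappa> \<phi>)"

text \<open>The variables that the replacement can bring in, and hence those whose capture has to be
  ruled out.\<close>

definition crange :: "('k \<Rightarrow> ('c, 'f) tm) \<Rightarrow> nat set" where
  "crange \<kappa> = (\<Union>c. tm_vars (\<kappa> c))"

lemma tm_vars_csub: "tm_vars (tm_csub \<kappa> t) - crange \<kappa> = tm_vars t - crange \<kappa>"
  by (induction t) (auto simp: crange_def)

lemma fv_csub: "fv (fm_csub \<kappa> \<phi>) - crange \<kappa> = fv \<phi> - crange \<kappa>"
proof (induction \<phi>)
  case (Pred P ts)
  then show ?case using tm_vars_csub[of \<kappa>] by fastforce
qed auto

lemma fv_csub_iff: "x \<notin> crange \<kappa> \<Longrightarrow> x \<in> fv (fm_csub \<kappa> \<phi>) \<longleftrightarrow> x \<in> fv \<phi>"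
  using fv_csub[of \<kappa> \<phi>] by auto

text \<open>On the right the variables coming from \<open>\<kappa>\<close> are already present when
  the instantiation acts, on the left they are not; so \<open>\<sigma>\<close> has to fix
  them.\<close>

lemma tm_csub_inst:
  assumes "\<And>z. z \<in> crange \<kappa> \<Longrightarrow> \<sigma> z = Var z"
  shows "tm_csub \<kappa> (tm_inst \<sigma> t) = tm_inst (\<lambda>z. tm_csub \<kappa> (\<sigma> z)) (tm_csub \<kappa> t)"
proof (induction t)
  case (Const c)
  have "\<And>z. z \<in> tm_vars (\<kappa> c) \<Longrightarrow> \<sigma> z = Var z" using assms by (auto simp: crange_def)
  then show ?case by (simp add: tm_inst_ident)
qed auto

lemma fm_csub_inst:
  assumes "\<And>z. z \<in> crange \<kappa> \<Longrightarrow> \<sigma> z = Var z"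
  shows "fm_csub \<kappa> (fm_inst \<sigma> \<phi>) = fm_inst (\<lambda>z. tm_csub \<kappa> (\<sigma> z)) (fm_csub \<kappa> \<phi>)"
  using assms
proof (induction \<phi> arbitrary: \<sigma>)
  case (Pred P ts)
  then show ?case by (auto intro: tm_csub_inst)
next
  case (Quant Q x \<phi>)
  have "(\<lambda>z. tm_csub \<kappa> ((\<sigma>(x := Var x)) z)) = (\<lambda>z. tm_csub \<kappa> (\<sigma> z))(x := Var x)"
    by auto
  moreover have "(\<sigma>(x := Var x)) z = Var z" if "z \<in> crange \<kappa>" for z
    using Quant.prems that by simp
  ultimately show ?case using Quant.IH[of "\<sigma>(x := Var x)"]
    by (simp del: fun_upd_apply)
qed auto

lemma fm_csub_subst:
  assumes "x \<notin> crange \<kappa>"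
  shows "fm_csub \<kappa> (\<phi>[x//t]) = (fm_csub \<kappa> \<phi>)[x//tm_csub \<kappa> t]"
proof -
  have "(\<lambda>z. tm_csub \<kappa> ((Var(x := t)) z)) = Var(x := tm_csub \<kappa> t)" by auto
  moreover have "(Var(x := t)) z = Var z" if "z \<in> crange \<kappa>" for z using that assms by auto
  ultimately show ?thesis using fm_csub_inst[of \<kappa> "Var(x := t)" \<phi>]
    unfolding subst_def by metis
qed

lemma free_for_csub:
  assumes "free_for t x \<phi>" "x \<notin> crange \<kappa>" "fm_bv \<phi> \<inter> crange \<kappa> = {}"
  shows "free_for (tm_csub \<kappa> t) x (fm_csub \<kappa> \<phi>)"
  using assms
proof (induction \<phi>)
  case (Quant Q y \<phi>)
  then show ?case using fv_csub_iff[of x \<kappa> \<phi>] tm_vars_csub[of \<kappa> t] by auto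
qed auto

lemma tm_csub_csub: "tm_csub \<kappa> (tm_csub \<rho> t) = tm_csub (\<lambda>c. tm_csub \<kappa> (\<rho> c)) t"
  by (induction t) auto

lemma fm_csub_csub: "fm_csub \<kappa> (fm_csub \<rho> \<phi>) = fm_csub (\<lambda>c. tm_csub \<kappa> (\<rho> c)) \<phi>"
  by (induction \<phi>) (auto simp: tm_csub_csub)

lemma tm_csub_cong: "(\<And>c. c \<in> set1_tm t \<Longrightarrow> \<kappa> c = \<rho> c) \<Longrightarrow> tm_csub \<kappa> t = tm_csub \<rho> t"
  by (induction t) auto

lemma fm_csub_cong: "(\<And>c. c \<in> set1_fm \<phi> \<Longrightarrow> \<kappa> c = \<rho> c) \<Longrightarrow> fm_csub \<kappa> \<phi> = fm_csub \<rho> \<phi>"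
  by (induction \<phi>) (auto intro!: tm_csub_cong)

lemma tm_csub_Const [simp]: "tm_csub Const t = t"
  by (induction t) (auto intro: map_idI)

lemma fm_csub_Const [simp]: "fm_csub Const \<phi> = \<phi>"
  by (induction \<phi>) (auto intro: map_idI)

lemma fm_csub_ident: "(\<And>c. c \<in> set1_fm \<phi> \<Longrightarrow> \<kappa> c = Const c) \<Longrightarrow> fm_csub \<kappa> \<phi> = \<phi>"
  using fm_csub_cong[of \<phi> \<kappa> Const] by simp

lemma map_tm_csub: "map_tm g (\<lambda>f. f) t = tm_csub (\<lambda>c. Const (g c)) t"
  by (induction t) auto

lemma map_fm_csub: "map_fm g (\<lambda>f. f) (\<lambda>p. p) \<phi> = fm_csub (\<lambda>c. Const (g c)) \<phi>"
  by (induction \<phi>) (auto simp: map_tm_csub)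

lemma tm_csub_Ter:
  assumes "t \<in> Ter \<Theta>" "\<And>c. c \<in> sig_consts \<Theta> \<Longrightarrow> \<kappa> c \<in> Ter \<Theta>'" "sig_funs \<Theta>' = sig_funs \<Theta>"
  shows "tm_csub \<kappa> t \<in> Ter \<Theta>'"
  using assms by (induction t) auto

lemma fm_csub_For:
  assumes "\<phi> \<in> For \<Theta>" "\<And>c. c \<in> sig_consts \<Theta> \<Longrightarrow> \<kappa> c \<in> Ter \<Theta>'"
    "sig_funs \<Theta>' = sig_funs \<Theta>" "sig_preds \<Theta>' = sig_preds \<Theta>"
  shows "fm_csub \<kappa> \<phi> \<in> For \<Theta>'"
  using assms by (induction \<phi>) (auto intro: tm_csub_Ter)

text \<open>A derivation is not itself an object, so the freshness of a variable \<open>y\<close> for it is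
  expressed by cofiniteness in \<open>y\<close>. Constant families \<open>\<kappa>\<close> cover the replacement by
  closed terms.\<close>

lemma eventually_fresh: "finite F \<Longrightarrow> \<forall>\<^sub>F y in cofinite. y \<notin> (F :: 'v set)"
  by (simp add: eventually_cofinite)

text \<open>No finite set of exceptions can be read off from \<open>\<phi>\<close> and
  \<open>\<psi>\<close>: transitivity hides intermediate formulas with bound variables of their own.
  Cofinite statements absorb them, each rule adding finitely many exceptions.\<close>

lemma variant_csub:
  fixes \<kappa> :: "nat \<Rightarrow> 'k \<Rightarrow> ('c, 'f) tm"
  assumes "variant \<phi> \<psi>" and \<kappa>: "\<And>y. crange (\<kappa> y) \<subseteq> {y}"
  shows "\<forall>\<^sub>F y in cofinite. variant (fm_csub (\<kappa> y) \<phi>) (fm_csub (\<kappa> y) \<psi>)"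
  using assms(1)
proof (induction rule: variant.induct)
  case (void x \<phi> Q)
  have "\<forall>\<^sub>F y in cofinite. y \<notin> {x}" by (intro eventually_fresh) simp
  then show ?case
  proof eventually_elim
    case (elim y)
    then have "x \<notin> crange (\<kappa> y)" using \<kappa> by auto
    then show ?case using void by (simp add: fv_csub_iff variant.void)
  qed
next
  case (rename z \<phi> x Q)
  have "\<forall>\<^sub>F y in cofinite. y \<notin> insert x (insert z (fm_bv \<phi>))" by (intro eventually_fresh) simp
  then show ?case
  proof eventually_elim
    case (elim y)
    then have *: "x \<notin> crange (\<kappa> y)" "z \<notin> crange (\<kappa> y)" "fm_bv \<phi> \<inter> crange (\<kappa> y) = {}"
      using \<kappa>[of y] by auto
    then show ?case
      using variant.rename[of z "fm_csub (\<kappa> y) \<phi>" x Q] rename free_for_csub[of "Var z" x \<phi> "\<kappa> y"]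
      by (simp add: fm_csub_subst fv_csub_iff)
  qed
next
  case (trans \<phi> \<psi> \<chi>)
  from trans.IH show ?case by eventually_elim (auto intro: variant.trans)
next
  case (Binary \<phi> \<phi>' \<psi> \<psi>' b)
  from Binary.IH show ?case by eventually_elim (auto intro: variant.Binary)
next
  case (sym \<phi> \<psi>)
  from sym.IH show ?case by eventually_elim (auto intro: variant.sym)
next
  case (Unary \<phi> \<phi>' u)
  from Unary.IH show ?case by eventually_elim (auto intro: variant.Unary)
next
  case (Quant \<phi> \<phi>' Q x)
  from Quant.IH show ?case by eventually_elim (auto intro: variant.Quant)
qed (simp add: variant.refl)

lemma axiom_csub:
  fixes \<kappa> :: "nat \<Rightarrow> 'k \<Rightarrow> ('c, 'f) tm"
  assumes "qmbc_axiom \<phi>" and \<kappa>: "\<And>y. crange (\<kappa> y) \<subseteq> {y}"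
  shows "\<forall>\<^sub>F y in cofinite. qmbc_axiom (fm_csub (\<kappa> y) \<phi>)"
  using assms(1)
proof cases
  case (Ax12 t x \<psi>)
  have "\<forall>\<^sub>F y in cofinite. y \<notin> insert x (fm_bv \<psi>)" by (intro eventually_fresh) simp
  then show ?thesis
  proof eventually_elim
    case (elim y)
    then have "x \<notin> crange (\<kappa> y)" "fm_bv \<psi> \<inter> crange (\<kappa> y) = {}"
      using \<kappa>[of y] by auto
    then show ?case using Ax12 free_for_csub[of t x \<psi> "\<kappa> y"]
      by (simp add: fm_csub_subst qmbc_axiom.Ax12)
  qed
next
  case (Ax13 t x \<psi>)
  have "\<forall>\<^sub>F y in cofinite. y \<notin> insert x (fm_bv \<psi>)" by (intro eventually_fresh) simp
  then show ?thesis
  proof eventually_elim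
    case (elim y)
    then have "x \<notin> crange (\<kappa> y)" "fm_bv \<psi> \<inter> crange (\<kappa> y) = {}"
      using \<kappa>[of y] by auto
    then show ?case using Ax13 free_for_csub[of t x \<psi> "\<kappa> y"]
      by (simp add: fm_csub_subst qmbc_axiom.Ax13)
  qed
next
  case (Ax14 \<alpha> \<beta>)
  show ?thesis unfolding Ax14(1) fm_csub.simps
    using variant_csub[OF Ax14(2) \<kappa>] by eventually_elim (rule qmbc_axiom.Ax14)
qed (simp_all add: qmbc_axiom.intros)

text \<open>The two signatures may differ in their constants, so this serves both to turn one
  constant into a variable within a language and to return from the Henkin language to
  \<open>\<Theta>\<close>.\<close>

lemma derivable_csub:
  fixes \<kappa> :: "nat \<Rightarrow> 'k \<Rightarrow> ('c, 'f) tm"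
  assumes "qmbc_derivable \<Theta> \<Gamma> \<phi>" "sig_funs \<Theta>' = sig_funs \<Theta>" "sig_preds \<Theta>' = sig_preds \<Theta>"
    and \<kappa>: "\<And>y. crange (\<kappa> y) \<subseteq> {y}" "\<And>y c. c \<in> sig_consts \<Theta> \<Longrightarrow> \<kappa> y c \<in> Ter \<Theta>'"
  shows "\<forall>\<^sub>F y in cofinite. qmbc_derivable \<Theta>' (fm_csub (\<kappa> y) ` \<Gamma>) (fm_csub (\<kappa> y) \<phi>)"
  using assms(1)
proof (induction rule: qmbc_derivable.induct)
  case (Axiom \<phi>)
  have "fm_csub (\<kappa> y) \<phi> \<in> For \<Theta>'" for y
    using Axiom(2) \<kappa>(2) assms(2,3) by (rule fm_csub_For)
  then show ?case
    using axiom_csub[OF Axiom(1) \<kappa>(1)] by (auto elim!: eventually_mono simp add: qmbc_derivable.Axiom)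
next
  case (Premise \<phi>)
  then show ?case by (simp add: qmbc_derivable.Premise)
next
  case (MP \<alpha> \<beta>)
  from MP.IH show ?case
    by eventually_elim (auto intro: qmbc_derivable.MP)
next
  case (Ex_In \<phi> \<psi> x)
  have "\<forall>\<^sub>F y in cofinite. y \<notin> {x}" by (intro eventually_fresh) simp
  with Ex_In.IH show ?case
  proof eventually_elim
    case (elim y)
    then have "x \<notin> crange (\<kappa> y)" using \<kappa>(1) by auto
    then show ?case using elim Ex_In(2) by (simp add: fv_csub_iff qmbc_derivable.Ex_In)
  qed
next
  case (All_In \<phi> \<psi> x)
  have "\<forall>\<^sub>F y in cofinite. y \<notin> {x}" by (intro eventually_fresh) simp
  with All_In.IH show ?case
  proof eventually_elim
    case (elim y)
    then have "x \<notin> crange (\<kappa> y)" using \<kappa>(1) by auto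
    then show ?case using elim All_In(2) by (simp add: fv_csub_iff qmbc_derivable.All_In)
  qed
qed


section \<open>Derived rules of QmbC\<close>

lemma derivable_For: "qmbc_derivable \<Theta> \<Gamma> \<phi> \<Longrightarrow> \<Gamma> \<subseteq> For \<Theta> \<Longrightarrow> \<phi> \<in> For \<Theta>"
  by (induction rule: qmbc_derivable.induct) auto

lemma derivable_mono: "qmbc_derivable \<Theta> \<Gamma> \<phi> \<Longrightarrow> \<Gamma> \<subseteq> \<Delta> \<Longrightarrow> qmbc_derivable \<Theta> \<Delta> \<phi>"
  by (induction rule: qmbc_derivable.induct) (auto intro: qmbc_derivable.intros)

lemma derivable_compact:
  "qmbc_derivable \<Theta> \<Gamma> \<phi> \<Longrightarrow> \<exists>\<Delta>. finite \<Delta> \<and> \<Delta> \<subseteq> \<Gamma> \<and> qmbc_derivable \<Theta> \<Delta> \<phi>"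
proof (induction rule: qmbc_derivable.induct)
  case (Axiom \<phi>)
  then show ?case by (intro exI[of _ "{}"]) (auto intro: qmbc_derivable.Axiom)
next
  case (Premise \<phi>)
  then show ?case by (intro exI[of _ "{\<phi>}"]) (auto intro: qmbc_derivable.Premise)
next
  case (MP \<alpha> \<beta>)
  then obtain \<Delta> \<Delta>' where "finite \<Delta>" "\<Delta> \<subseteq> \<Gamma>" "qmbc_derivable \<Theta> \<Delta> \<alpha>"
    "finite \<Delta>'" "\<Delta>' \<subseteq> \<Gamma>" "qmbc_derivable \<Theta> \<Delta>' (\<alpha> \<^bold>\<rightarrow> \<beta>)" by blast
  then show ?case
    by (intro exI[of _ "\<Delta> \<union> \<Delta>'"]) (auto intro: qmbc_derivable.MP derivable_mono)
qed (blast intro: qmbc_derivable.intros)+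

text \<open>With premises in \<open>For \<Theta>\<close> every derivable expression is a formula, so
  the well-formedness of axiom instances can be read off from the formulas they are applied
  to.\<close>

locale hypotheses =
  fixes \<Theta> :: "('c, 'f, 'p) fo_signature" and \<Gamma> :: "('c, 'f, 'p) fm set"
  assumes hyps_For: "\<Gamma> \<subseteq> For \<Theta>"
begin

abbreviation derives :: "('c, 'f, 'p) fm \<Rightarrow> bool" ("\<turnstile> _" [50] 50) where
  "\<turnstile> \<phi> \<equiv> qmbc_derivable \<Theta> \<Gamma> \<phi>"

lemma For_of: "\<turnstile> \<phi> \<Longrightarrow> \<phi> \<in> For \<Theta>"
  using derivable_For hyps_For by blast

lemmas mp = qmbc_derivable.MP[of \<Theta> \<Gamma>]

lemma weaken:
  assumes "\<turnstile> \<beta>" "\<alpha> \<in> For \<Theta>"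
  shows "\<turnstile> \<alpha> \<^bold>\<rightarrow> \<beta>"
  by (rule mp[OF assms(1)], rule qmbc_derivable.Axiom[OF qmbc_axiom.A1])
    (use assms(2) For_of[OF assms(1)] in simp)

lemma distribute:
  assumes "\<turnstile> \<alpha> \<^bold>\<rightarrow> (\<beta> \<^bold>\<rightarrow> \<gamma>)" "\<turnstile> \<alpha> \<^bold>\<rightarrow> \<beta>"
  shows "\<turnstile> \<alpha> \<^bold>\<rightarrow> \<gamma>"
  by (rule mp[OF assms(2)], rule mp[OF assms(1)], rule qmbc_derivable.Axiom[OF qmbc_axiom.A2])
    (use For_of[OF assms(1)] in simp)

lemma imp_refl: "\<alpha> \<in> For \<Theta> \<Longrightarrow> \<turnstile> \<alpha> \<^bold>\<rightarrow> \<alpha>"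
  by (rule distribute[of _ "\<alpha> \<^bold>\<rightarrow> \<alpha>"]) (auto intro: qmbc_derivable.Axiom qmbc_axiom.A1)

lemma imp_trans:
  assumes "\<turnstile> \<alpha> \<^bold>\<rightarrow> \<beta>" "\<turnstile> \<beta> \<^bold>\<rightarrow> \<gamma>"
  shows "\<turnstile> \<alpha> \<^bold>\<rightarrow> \<gamma>"
  using distribute[OF weaken[OF assms(2)] assms(1)] For_of[OF assms(1)] by simp

lemma imp_swap:
  assumes "\<turnstile> \<alpha> \<^bold>\<rightarrow> (\<beta> \<^bold>\<rightarrow> \<gamma>)"
  shows "\<turnstile> \<beta> \<^bold>\<rightarrow> (\<alpha> \<^bold>\<rightarrow> \<gamma>)"
proof -
  have F: "\<alpha> \<in> For \<Theta>" "\<beta> \<in> For \<Theta>" "\<gamma> \<in> For \<Theta>" using For_of[OF assms] by auto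
  have "\<turnstile> (\<alpha> \<^bold>\<rightarrow> \<beta>) \<^bold>\<rightarrow> (\<alpha> \<^bold>\<rightarrow> \<gamma>)"
    by (rule mp[OF assms], rule qmbc_derivable.Axiom[OF qmbc_axiom.A2]) (use F in simp)
  moreover have "\<turnstile> \<beta> \<^bold>\<rightarrow> (\<alpha> \<^bold>\<rightarrow> \<beta>)"
    by (rule qmbc_derivable.Axiom[OF qmbc_axiom.A1]) (use F in simp)
  ultimately show ?thesis by (rule imp_trans[rotated])
qed

lemma imp_import:
  assumes "\<turnstile> \<alpha> \<^bold>\<rightarrow> (\<beta> \<^bold>\<rightarrow> \<gamma>)"
  shows "\<turnstile> (\<alpha> \<^bold>\<and> \<beta>) \<^bold>\<rightarrow> \<gamma>"
proof (rule distribute)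
  have F: "\<alpha> \<in> For \<Theta>" "\<beta> \<in> For \<Theta>" using For_of[OF assms] by auto
  show "\<turnstile> (\<alpha> \<^bold>\<and> \<beta>) \<^bold>\<rightarrow> \<beta>"
    by (rule qmbc_derivable.Axiom[OF qmbc_axiom.A5]) (use F in simp)
  have "\<turnstile> (\<alpha> \<^bold>\<and> \<beta>) \<^bold>\<rightarrow> \<alpha>"
    by (rule qmbc_derivable.Axiom[OF qmbc_axiom.A4]) (use F in simp)
  then show "\<turnstile> (\<alpha> \<^bold>\<and> \<beta>) \<^bold>\<rightarrow> (\<beta> \<^bold>\<rightarrow> \<gamma>)"
    using assms by (rule imp_trans)
qed

lemma imp_export:
  assumes "\<turnstile> (\<alpha> \<^bold>\<and> \<beta>) \<^bold>\<rightarrow> \<gamma>"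
  shows "\<turnstile> \<alpha> \<^bold>\<rightarrow> (\<beta> \<^bold>\<rightarrow> \<gamma>)"
proof (rule imp_trans)
  have F: "\<alpha> \<in> For \<Theta>" "\<beta> \<in> For \<Theta>" using For_of[OF assms] by auto
  show "\<turnstile> \<alpha> \<^bold>\<rightarrow> (\<beta> \<^bold>\<rightarrow> (\<alpha> \<^bold>\<and> \<beta>))"
    by (rule qmbc_derivable.Axiom[OF qmbc_axiom.A3]) (use F in simp)
  show "\<turnstile> (\<beta> \<^bold>\<rightarrow> (\<alpha> \<^bold>\<and> \<beta>)) \<^bold>\<rightarrow> (\<beta> \<^bold>\<rightarrow> \<gamma>)"
    by (rule mp[OF weaken[OF assms F(2)]], rule qmbc_derivable.Axiom[OF qmbc_axiom.A2])
      (use For_of[OF assms] in simp)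
qed

lemma or_elim:
  assumes "\<turnstile> \<alpha> \<^bold>\<or> \<beta>" "\<turnstile> \<alpha> \<^bold>\<rightarrow> \<gamma>" "\<turnstile> \<beta> \<^bold>\<rightarrow> \<gamma>"
  shows "\<turnstile> \<gamma>"
  by (rule mp[OF assms(1)], rule mp[OF assms(3)], rule mp[OF assms(2)],
      rule qmbc_derivable.Axiom[OF qmbc_axiom.A8])
    (use For_of[OF assms(1)] For_of[OF assms(2)] in simp)

lemma excluded_middle:
  "\<alpha> \<in> For \<Theta> \<Longrightarrow> \<beta> \<in> For \<Theta> \<Longrightarrow> \<turnstile> \<alpha> \<^bold>\<or> (\<alpha> \<^bold>\<rightarrow> \<beta>)"
  by (rule qmbc_derivable.Axiom[OF qmbc_axiom.A9]) simp

lemma variant_imp: "variant \<alpha> \<beta> \<Longrightarrow> \<alpha> \<in> For \<Theta> \<Longrightarrow> \<beta> \<in> For \<Theta> \<Longrightarrow> \<turnstile> \<alpha> \<^bold>\<rightarrow> \<beta>"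
  by (rule qmbc_derivable.Axiom[OF qmbc_axiom.Ax14]) auto

lemma all_elim:
  fixes \<phi> :: "('c, 'f, 'p) fm"
  assumes "\<turnstile> Quant Forall x \<phi>" "free_for t x \<phi>" "t \<in> Ter \<Theta>"
  shows "\<turnstile> \<phi>[x//t]"
  by (rule mp[OF assms(1)], rule qmbc_derivable.Axiom[OF qmbc_axiom.Ax13])
    (use assms For_of[OF assms(1)] in \<open>auto intro: subst_For\<close>)

lemma ex_intro:
  fixes \<phi> :: "('c, 'f, 'p) fm"
  assumes "\<turnstile> \<phi>[x//t]" "free_for t x \<phi>" "\<phi> \<in> For \<Theta>"
  shows "\<turnstile> Quant Exists x \<phi>"
  by (rule mp[OF assms(1)], rule qmbc_derivable.Axiom[OF qmbc_axiom.Ax12])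
    (use assms For_of[OF assms(1)] in \<open>auto\<close>)

lemma generalize:
  assumes "\<turnstile> \<phi>"
  shows "\<turnstile> Quant Forall x \<phi>"
proof -
  have F: "\<phi> \<in> For \<Theta>" using For_of[OF assms] .
  have "\<turnstile> \<alpha> \<^bold>\<rightarrow> Quant Forall x \<phi>" if "\<alpha> \<in> For \<Theta>" "x \<notin> fv \<alpha>" for \<alpha>
    using weaken[OF assms that(1)] that(2) by (rule qmbc_derivable.All_In)
  \<comment> \<open>The rule for \<open>Forall\<close> needs an antecedent in which \<open>x\<close>
    is not free; this one is moreover derivable, so it can be detached.\<close>
  from this[of "Quant Forall x \<phi> \<^bold>\<rightarrow> Quant Forall x \<phi>"] show ?thesis
    using F imp_refl[of "Quant Forall x \<phi>"] by (auto intro: mp)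
qed

text \<open>Generalization followed by (Ax13) treats one variable at a time, whereas
  \<open>fm_inst\<close> is simultaneous. Closed terms bring in no variables, so the finitely many
  free variables can be instantiated one after the other.\<close>

lemma inst_closed:
  assumes "\<turnstile> \<phi>" "\<And>x. \<sigma> x \<in> CTer \<Theta>"
  shows "\<turnstile> fm_inst \<sigma> \<phi>"
proof -
  have "\<turnstile> fm_inst (\<lambda>x. if x \<in> X then \<sigma> x else Var x) \<phi>" if "finite X" for X
    using that
  proof induction
    case empty
    then show ?case using assms(1) by simp
  next
    case (insert x X)
    let ?\<tau> = "\<lambda>x. if x \<in> X then \<sigma> x else Var x"
    have "tm_inst (Var(x := \<sigma> x)) (?\<tau> y) = (if y \<in> insert x X then \<sigma> y else Var y)" for y
      using assms(2)[of y] insert(2) by (auto simp: CTer_def intro: tm_inst_ident)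
    moreover have "(fm_inst ?\<tau> \<phi>)[x//\<sigma> x] = fm_inst (\<lambda>y. tm_inst (Var(x := \<sigma> x)) (?\<tau> y)) \<phi>"
      unfolding subst_def using assms(2) by (intro fm_inst_inst) (auto simp: CTer_def)
    moreover have "\<turnstile> (fm_inst ?\<tau> \<phi>)[x//\<sigma> x]"
      using assms(2)[of x] by (intro all_elim generalize insert.IH) (auto simp: CTer_def intro: free_for_closed)
    ultimately show ?case by simp
  qed
  from this[of "fv \<phi>"] show ?thesis
    using fm_inst_cong[of \<phi> "\<lambda>x. if x \<in> fv \<phi> then \<sigma> x else Var x" \<sigma>] by simp
qed

text \<open>Since \<open>\<alpha>\<close> is a sentence, it can join either side of an implication
  without disturbing the side conditions of the quantifier rules: it is swapped into the consequent
  for \<open>Ex_In\<close> and conjoined to the antecedent for \<open>All_In\<close>.\<close>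

lemma deduction:
  assumes "qmbc_derivable \<Theta> (insert \<alpha> \<Gamma>) \<beta>" "\<alpha> \<in> Sen \<Theta>"
  shows "\<turnstile> \<alpha> \<^bold>\<rightarrow> \<beta>"
  using assms(1)
proof (induction rule: qmbc_derivable.induct)
  have \<alpha>: "\<alpha> \<in> For \<Theta>" "fv \<alpha> = {}" using assms(2) by (auto simp: Sen_def)
  {
    case (Axiom \<phi>)
    then show ?case using \<alpha> by (intro weaken qmbc_derivable.Axiom)
  next
    case (Premise \<phi>)
    then show ?case using \<alpha> by (auto intro: imp_refl weaken qmbc_derivable.Premise)
  next
    case (MP \<beta> \<gamma>)
    then show ?case using distribute by blast
  next
    case (Ex_In \<phi> \<psi> x)
    have "\<turnstile> Quant Exists x \<phi> \<^bold>\<rightarrow> (\<alpha> \<^bold>\<rightarrow> \<psi>)"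
      using imp_swap[OF Ex_In.IH] by (rule qmbc_derivable.Ex_In) (use \<alpha> Ex_In(2) in simp)
    then show ?case by (rule imp_swap)
  next
    case (All_In \<phi> \<psi> x)
    have "\<turnstile> (\<alpha> \<^bold>\<and> \<phi>) \<^bold>\<rightarrow> Quant Forall x \<psi>"
      using imp_import[OF All_In.IH] by (rule qmbc_derivable.All_In) (use \<alpha> All_In(2) in simp)
    then show ?case by (rule imp_export)
  }
qed

text \<open>By (A1) the instance at \<open>y\<close> implies the witness axiom, hence
  \<open>\<phi>\<close>; as \<open>y\<close> is fresh, the existential formula implies
  \<open>\<phi>\<close> too. By (A9) either the existential formula or the witness axiom is
  available, and both lead to \<open>\<phi>\<close>.\<close>

lemma drop_ex_witness:
  fixes \<phi> \<psi> :: "('c, 'f, 'p) fm"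
  assumes d: "\<turnstile> (Quant Exists x \<psi> \<^bold>\<rightarrow> \<psi>[x//Var y]) \<^bold>\<rightarrow> \<phi>"
    and y: "y \<notin> fv \<psi>" "y \<notin> fm_bv \<psi>" "y \<notin> fv \<phi>"
  shows "\<turnstile> \<phi>"
proof -
  have F: "\<psi> \<in> For \<Theta>" "\<psi>[x//Var y] \<in> For \<Theta>" "\<phi> \<in> For \<Theta>" using For_of[OF d] by auto
  have "variant (Quant Exists x \<psi>) (Quant Exists y (\<psi>[x//Var y]))"
    using y by (intro variant.rename free_for_fresh) auto
  then have "\<turnstile> Quant Exists x \<psi> \<^bold>\<rightarrow> Quant Exists y (\<psi>[x//Var y])"
    using F by (intro variant_imp) auto
  moreover have "\<turnstile> \<psi>[x//Var y] \<^bold>\<rightarrow> \<phi>"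
    by (rule imp_trans[OF _ d], rule qmbc_derivable.Axiom[OF qmbc_axiom.A1]) (use F in simp)
  then have "\<turnstile> Quant Exists y (\<psi>[x//Var y]) \<^bold>\<rightarrow> \<phi>"
    using y(3) by (rule qmbc_derivable.Ex_In)
  ultimately have "\<turnstile> Quant Exists x \<psi> \<^bold>\<rightarrow> \<phi>" by (rule imp_trans)
  then show ?thesis using d by (rule or_elim[rotated]) (use F excluded_middle in auto)
qed

text \<open>Classically: if \<open>\<phi>\<close> failed, so would the witness axiom, hence
  \<open>?A\<close> would hold for an arbitrary \<open>y\<close>, which yields \<open>?B\<close> and
  with it \<open>\<phi>\<close>. The argument is carried out positively, with two uses of
  (A9).\<close>

lemma drop_all_witness:
  fixes \<phi> \<psi> :: "('c, 'f, 'p) fm"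
  assumes d: "\<turnstile> (\<psi>[x//Var y] \<^bold>\<rightarrow> Quant Forall x \<psi>) \<^bold>\<rightarrow> \<phi>"
    and y: "y \<notin> fv \<psi>" "y \<notin> fm_bv \<psi>" "y \<notin> fv \<phi>"
  shows "\<turnstile> \<phi>"
proof -
  let ?A = "\<psi>[x//Var y]" and ?B = "Quant Forall x \<psi>"
  have F: "\<psi> \<in> For \<Theta>" "?A \<in> For \<Theta>" "\<phi> \<in> For \<Theta>" using For_of[OF d] by auto
  have B: "\<turnstile> ?B \<^bold>\<rightarrow> \<phi>"
    by (rule imp_trans[OF _ d], rule qmbc_derivable.Axiom[OF qmbc_axiom.A1]) (use F in simp)
  have "variant ?B (Quant Forall y ?A)"
    using y by (intro variant.rename free_for_fresh) auto
  then have AB: "\<turnstile> Quant Forall y ?A \<^bold>\<rightarrow> ?B"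
    using F by (intro variant_imp) (auto intro: variant.sym)
  \<comment> \<open>Stands in for the negation of \<open>\<phi>\<close>. The variable
    \<open>y\<close> is not free in it, so \<open>?A\<close> can be generalized under it.\<close>
  let ?N = "\<phi> \<^bold>\<rightarrow> ?B"
  have "\<turnstile> ?N \<^bold>\<rightarrow> ?A"
  proof (rule or_elim[OF excluded_middle[OF F(2), of ?B]])
    show "\<turnstile> ?A \<^bold>\<rightarrow> (?N \<^bold>\<rightarrow> ?A)"
      by (rule qmbc_derivable.Axiom[OF qmbc_axiom.A1]) (use F in simp)
    have "\<turnstile> ?B \<^bold>\<rightarrow> ?A"
      by (rule qmbc_derivable.Axiom[OF qmbc_axiom.Ax13]) (use F y in \<open>auto intro: free_for_fresh\<close>)
    moreover have "\<turnstile> (?N \<^bold>\<and> \<phi>) \<^bold>\<rightarrow> ?B"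
      by (rule imp_import, rule imp_refl) (use F in simp)
    ultimately have "\<turnstile> ?N \<^bold>\<rightarrow> (\<phi> \<^bold>\<rightarrow> ?A)"
      by (rule imp_export[OF imp_trans, rotated])
    then show "\<turnstile> (?A \<^bold>\<rightarrow> ?B) \<^bold>\<rightarrow> (?N \<^bold>\<rightarrow> ?A)"
      by (rule imp_trans[OF d imp_swap])
  qed (use F in simp)
  then have "\<turnstile> ?N \<^bold>\<rightarrow> Quant Forall y ?A"
    by (rule qmbc_derivable.All_In) (use y in auto)
  then have "\<turnstile> ?N \<^bold>\<rightarrow> \<phi>"
    using imp_trans[OF AB B] by (rule imp_trans)
  then show ?thesis
    by (rule or_elim[OF excluded_middle imp_refl, rotated 3]) (use F in auto)
qed

end

section \<open>Eliminating a single witness axiom\<close>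

lemma csub_const_subst:
  fixes \<psi> :: "('c, 'f, 'p) fm"
  assumes "c \<notin> set1_fm \<psi>" "y \<noteq> x"
  shows "fm_csub (Const(c := Var y)) (\<psi>[x//Const c]) = \<psi>[x//Var y]"
proof -
  let ?\<kappa> = "Const(c := Var y) :: 'c \<Rightarrow> ('c, 'f) tm"
  have "x \<notin> crange ?\<kappa>" using assms(2) by (auto simp: crange_def)
  moreover have "fm_csub (Const(c := Var y)) \<psi> = \<psi>"
    using assms(1) by (intro fm_csub_ident) auto
  ultimately show ?thesis by (simp add: fm_csub_subst)
qed

text \<open>Each quantifier has its own axiom: with a paraconsistent negation the universal one is
  not handled as the dual of the existential one.\<close>

fun henkin_ax :: "quant \<Rightarrow> nat \<Rightarrow> ('c, 'f, 'p) fm \<Rightarrow> 'c \<Rightarrow> ('c, 'f, 'p) fm" where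
  "henkin_ax Exists x \<psi> c = (Quant Exists x \<psi> \<^bold>\<rightarrow> \<psi>[x//Const c])"
| "henkin_ax Forall x \<psi> c = (\<psi>[x//Const c] \<^bold>\<rightarrow> Quant Forall x \<psi>)"

lemma henkin_ax_Sen:
  assumes "Quant Q x \<psi> \<in> Sen \<Theta>" "c \<in> sig_consts \<Theta>"
  shows "henkin_ax Q x \<psi> c \<in> Sen \<Theta>"
proof -
  have "fv (\<psi>[x//Const c]) = {}"
    using assms(1) fv_inst_subset[of "Var(x := Const c)" \<psi>]
    by (fastforce simp: Sen_def subst_def split: if_splits)
  then show ?thesis using assms by (cases Q) (auto simp: Sen_def subst_For)
qed

text \<open>Discharge the axiom, then replace \<open>c\<close> by a fresh variable \<open>y\<close>.
  As \<open>c\<close> occurs in neither \<open>\<Gamma>\<close>, \<open>\<phi>\<close> nor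
  \<open>\<psi>\<close>, only the witness instance changes, and the two preceding elimination lemmas
  apply.\<close>

lemma drop_henkin_ax:
  assumes d: "qmbc_derivable \<Theta> (insert (henkin_ax Q x \<psi> c) \<Gamma>) \<phi>"
    and F: "\<Gamma> \<subseteq> For \<Theta>" "Quant Q x \<psi> \<in> Sen \<Theta>" "c \<in> sig_consts \<Theta>"
    and c: "c \<notin> set1_fm \<psi>" "c \<notin> set1_fm \<phi>" "\<And>\<gamma>. \<gamma> \<in> \<Gamma> \<Longrightarrow> c \<notin> set1_fm \<gamma>"
  shows "qmbc_derivable \<Theta> \<Gamma> \<phi>"
proof -
  interpret hypotheses \<Theta> \<Gamma> by unfold_locales fact
  let ?\<kappa> = "\<lambda>y. Const(c := Var y)"
  have "\<turnstile> henkin_ax Q x \<psi> c \<^bold>\<rightarrow> \<phi>"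
    by (rule deduction[OF d henkin_ax_Sen]) fact+
  then have "\<forall>\<^sub>F y in cofinite. qmbc_derivable \<Theta> (fm_csub (?\<kappa> y) ` \<Gamma>) (fm_csub (?\<kappa> y) (henkin_ax Q x \<psi> c \<^bold>\<rightarrow> \<phi>))"
    by (rule derivable_csub) (auto simp: crange_def split: if_splits)
  moreover have "\<forall>\<^sub>F y in cofinite. y \<notin> insert x (fv \<psi> \<union> fm_bv \<psi> \<union> fv \<phi>)"
    by (intro eventually_fresh) simp
  ultimately have "\<forall>\<^sub>F y in cofinite.
      qmbc_derivable \<Theta> (fm_csub (?\<kappa> y) ` \<Gamma>) (fm_csub (?\<kappa> y) (henkin_ax Q x \<psi> c \<^bold>\<rightarrow> \<phi>)) \<and>
      y \<notin> insert x (fv \<psi> \<union> fm_bv \<psi> \<union> fv \<phi>)"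
    by (rule eventually_conj)
  \<comment> \<open>There are infinitely many variables, so a cofinite property has an
    instance.\<close>
  then obtain y where
    d: "qmbc_derivable \<Theta> (fm_csub (?\<kappa> y) ` \<Gamma>) (fm_csub (?\<kappa> y) (henkin_ax Q x \<psi> c \<^bold>\<rightarrow> \<phi>))"
    and y: "y \<notin> insert x (fv \<psi> \<union> fm_bv \<psi> \<union> fv \<phi>)"
    using eventually_happens'[of "cofinite :: nat filter"] by auto
  have "fm_csub (?\<kappa> y) \<gamma> = \<gamma>" if "\<gamma> \<in> \<Gamma>" for \<gamma>
    using c(3)[OF that] by (intro fm_csub_ident) auto
  then have "fm_csub (?\<kappa> y) ` \<Gamma> = \<Gamma>" by simp
  moreover have "fm_csub (?\<kappa> y) \<phi> = \<phi>" "fm_csub (?\<kappa> y) \<psi> = \<psi>"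
    using c(1,2) by (auto intro: fm_csub_ident)
  ultimately show ?thesis
    using d y drop_ex_witness[of x \<psi> y \<phi>] drop_all_witness[of \<psi> x y \<phi>] csub_const_subst[OF c(1), of y x]
    by (cases Q) auto
qed


section \<open>Saturated theories\<close>

text \<open>Zorn's lemma, because the signature may be uncountable. The union of a chain stays
  admissible since a derivation uses finitely many premises. Only sentences are added, so that each
  of them can be discharged later.\<close>

lemma lindenbaum:
  assumes "\<not> qmbc_derivable \<Theta> \<Gamma> \<phi>"
  obtains S where "S \<subseteq> Sen \<Theta>" "\<not> qmbc_derivable \<Theta> (\<Gamma> \<union> S) \<phi>"
    "\<And>\<alpha>. \<alpha> \<in> Sen \<Theta> \<Longrightarrow> \<alpha> \<notin> S \<Longrightarrow> qmbc_derivable \<Theta> (insert \<alpha> (\<Gamma> \<union> S)) \<phi>"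
proof -
  define M where "M = {S. S \<subseteq> Sen \<Theta> \<and> \<not> qmbc_derivable \<Theta> (\<Gamma> \<union> S) \<phi>}"
  have "\<exists>U\<in>M. \<forall>X\<in>C. X \<subseteq> U" if C: "subset.chain M C" for C
  proof (cases "C = {}")
    case True
    then show ?thesis using assms by (intro bexI[of _ "{}"]) (auto simp: M_def)
  next
    case False
    have "\<not> qmbc_derivable \<Theta> (\<Gamma> \<union> \<Union>C) \<phi>"
    proof
      assume "qmbc_derivable \<Theta> (\<Gamma> \<union> \<Union>C) \<phi>"
      from derivable_compact[OF this] obtain \<Delta> where \<Delta>: "finite \<Delta>" "\<Delta> \<subseteq> \<Gamma> \<union> \<Union>C" "qmbc_derivable \<Theta> \<Delta> \<phi>"
        by blast
      then have "finite (\<Delta> - \<Gamma>)" "\<Delta> - \<Gamma> \<subseteq> \<Union>C" by auto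
      then obtain X where "X \<in> C" "\<Delta> - \<Gamma> \<subseteq> X"
        using finite_subset_Union_chain[OF _ _ False, of "\<Delta> - \<Gamma>" M] C by blast
      then have "\<Delta> \<subseteq> \<Gamma> \<union> X" "X \<in> M" using C by (auto simp: subset_chain_def M_def)
      then show False using derivable_mono[OF \<Delta>(3)] by (auto simp: M_def)
    qed
    moreover have "\<Union>C \<subseteq> Sen \<Theta>" using C by (auto simp: subset_chain_def M_def)
    ultimately show ?thesis by (intro bexI[of _ "\<Union>C"]) (auto simp: M_def)
  qed
  then have "\<exists>S\<in>M. \<forall>X\<in>M. S \<subseteq> X \<longrightarrow> X = S" by (rule subset_Zorn)
  then obtain S where S: "S \<in> M" "\<And>X. X \<in> M \<Longrightarrow> S \<subseteq> X \<Longrightarrow> X = S"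
    by (elim bexE) auto
  show ?thesis
  proof
    fix \<alpha> assume "\<alpha> \<in> Sen \<Theta>" "\<alpha> \<notin> S"
    then show "qmbc_derivable \<Theta> (insert \<alpha> (\<Gamma> \<union> S)) \<phi>"
      using S(1) S(2)[of "insert \<alpha> S"] by (auto simp: M_def)
  qed (use S(1) in \<open>auto simp: M_def\<close>)
qed

text \<open>Non-triviality is measured by the one formula \<open>\<phi>\<close>: a theory may
  contain some \<open>\<alpha>\<close> together with \<open>\<not>\<alpha>\<close> without deriving
  everything, so consistency would be the wrong requirement.\<close>

locale saturated = hypotheses \<Theta> \<Gamma> for \<Theta> :: "('c, 'f, 'p) fo_signature" and \<Gamma> +
  fixes \<phi> :: "('c, 'f, 'p) fm"
  assumes not_derives: "\<not> \<turnstile> \<phi>"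
    and maximal: "\<alpha> \<in> Sen \<Theta> \<Longrightarrow> \<not> \<turnstile> \<alpha> \<Longrightarrow> \<turnstile> \<alpha> \<^bold>\<rightarrow> \<phi>"
    and henkin: "Quant Q x \<psi> \<in> Sen \<Theta> \<Longrightarrow> \<exists>c\<in>sig_consts \<Theta>. \<turnstile> henkin_ax Q x \<psi> c"
begin

text \<open>If neither disjunct is derivable, both imply \<open>\<phi>\<close> by maximality, and
  (A8) would derive \<open>\<phi>\<close>.\<close>

lemma derives_or:
  assumes "\<alpha> \<in> Sen \<Theta>" "\<beta> \<in> Sen \<Theta>"
  shows "\<turnstile> \<alpha> \<^bold>\<or> \<beta> \<longleftrightarrow> \<turnstile> \<alpha> \<or> \<turnstile> \<beta>"
proof
  assume "\<turnstile> \<alpha> \<^bold>\<or> \<beta>"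
  then show "\<turnstile> \<alpha> \<or> \<turnstile> \<beta>"
    using or_elim[of \<alpha> \<beta> \<phi>] maximal assms not_derives by blast
next
  have "\<turnstile> \<alpha> \<^bold>\<rightarrow> (\<alpha> \<^bold>\<or> \<beta>)" "\<turnstile> \<beta> \<^bold>\<rightarrow> (\<alpha> \<^bold>\<or> \<beta>)"
    using assms by (auto simp: Sen_def intro: qmbc_derivable.Axiom qmbc_axiom.A6 qmbc_axiom.A7)
  then show "\<turnstile> \<alpha> \<or> \<turnstile> \<beta> \<Longrightarrow> \<turnstile> \<alpha> \<^bold>\<or> \<beta>" using mp by blast
qed

text \<open>When \<open>\<alpha>\<close> is underivable, (A9) and the disjunction property leave
  only \<open>\<alpha> \<rightarrow> \<beta>\<close>.\<close>

lemma derives_imp: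
  assumes "\<alpha> \<in> Sen \<Theta>" "\<beta> \<in> Sen \<Theta>"
  shows "\<turnstile> \<alpha> \<^bold>\<rightarrow> \<beta> \<longleftrightarrow> (\<turnstile> \<alpha> \<longrightarrow> \<turnstile> \<beta>)"
  using derives_or[of \<alpha> "\<alpha> \<^bold>\<rightarrow> \<beta>"] excluded_middle[of \<alpha> \<beta>] weaken[of \<beta> \<alpha>] mp[of \<alpha> \<beta>] assms
  by (auto simp: Sen_def)

lemma derives_and:
  assumes "\<alpha> \<in> Sen \<Theta>" "\<beta> \<in> Sen \<Theta>"
  shows "\<turnstile> \<alpha> \<^bold>\<and> \<beta> \<longleftrightarrow> \<turnstile> \<alpha> \<and> \<turnstile> \<beta>"
proof -
  have "\<turnstile> \<alpha> \<^bold>\<rightarrow> (\<beta> \<^bold>\<rightarrow> (\<alpha> \<^bold>\<and> \<beta>))" "\<turnstile> (\<alpha> \<^bold>\<and> \<beta>) \<^bold>\<rightarrow> \<alpha>" "\<turnstile> (\<alpha> \<^bold>\<and> \<beta>) \<^bold>\<rightarrow> \<beta>"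
    using assms
    by (auto simp: Sen_def intro: qmbc_derivable.Axiom qmbc_axiom.A3 qmbc_axiom.A4 qmbc_axiom.A5)
  then show ?thesis using mp by blast
qed

lemma derives_neg:
  assumes "\<alpha> \<in> Sen \<Theta>"
  shows "\<turnstile> \<alpha> \<or> \<turnstile> \<^bold>\<not> \<alpha>"
proof -
  have "\<turnstile> \<alpha> \<^bold>\<or> (\<^bold>\<not> \<alpha>)"
    using assms by (auto simp: Sen_def intro: qmbc_derivable.Axiom qmbc_axiom.A10)
  then show ?thesis using derives_or[of \<alpha> "\<^bold>\<not> \<alpha>"] assms by (simp add: Sen_def)
qed

text \<open>(A11) with \<open>\<phi>\<close> as the arbitrary conclusion.\<close>

lemma derives_circ:
  assumes "\<phi> \<in> For \<Theta>"
  shows "\<not> (\<turnstile> \<alpha> \<and> \<turnstile> \<^bold>\<not> \<alpha> \<and> \<turnstile> \<^bold>\<circ> \<alpha>)"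
proof
  assume *: "\<turnstile> \<alpha> \<and> \<turnstile> \<^bold>\<not> \<alpha> \<and> \<turnstile> \<^bold>\<circ> \<alpha>"
  then have "\<turnstile> (\<^bold>\<circ> \<alpha>) \<^bold>\<rightarrow> (\<alpha> \<^bold>\<rightarrow> ((\<^bold>\<not> \<alpha>) \<^bold>\<rightarrow> \<phi>))"
    using assms For_of[of \<alpha>] by (auto intro: qmbc_derivable.Axiom qmbc_axiom.A11)
  then show False using * mp not_derives by blast
qed

text \<open>From right to left, the witness constant is itself a closed term, so its instance is
  among the assumptions.\<close>

lemma derives_all:
  fixes \<psi> :: "('c, 'f, 'p) fm"
  assumes "Quant Forall x \<psi> \<in> Sen \<Theta>"
  shows "\<turnstile> Quant Forall x \<psi> \<longleftrightarrow> (\<forall>t\<in>CTer \<Theta>. \<turnstile> \<psi>[x//t])"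
proof
  assume "\<turnstile> Quant Forall x \<psi>"
  then show "\<forall>t\<in>CTer \<Theta>. \<turnstile> \<psi>[x//t]"
    by (auto simp: CTer_def intro: all_elim free_for_closed)
next
  assume *: "\<forall>t\<in>CTer \<Theta>. \<turnstile> \<psi>[x//t]"
  obtain c where "c \<in> sig_consts \<Theta>" "\<turnstile> \<psi>[x//Const c] \<^bold>\<rightarrow> Quant Forall x \<psi>"
    using henkin[OF assms] by auto
  moreover from this(1) have "\<turnstile> \<psi>[x//Const c]" using * by (simp add: CTer_def)
  ultimately show "\<turnstile> Quant Forall x \<psi>" using mp by blast
qed

lemma derives_ex:
  fixes \<psi> :: "('c, 'f, 'p) fm"
  assumes "Quant Exists x \<psi> \<in> Sen \<Theta>"
  shows "\<turnstile> Quant Exists x \<psi> \<longleftrightarrow> (\<exists>t\<in>CTer \<Theta>. \<turnstile> \<psi>[x//t])"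
proof
  assume "\<exists>t\<in>CTer \<Theta>. \<turnstile> \<psi>[x//t]"
  then show "\<turnstile> Quant Exists x \<psi>"
    using assms by (auto simp: CTer_def Sen_def intro: ex_intro free_for_closed)
next
  assume *: "\<turnstile> Quant Exists x \<psi>"
  obtain c where c: "c \<in> sig_consts \<Theta>" "\<turnstile> Quant Exists x \<psi> \<^bold>\<rightarrow> \<psi>[x//Const c]"
    using henkin[OF assms] by auto
  then have "\<turnstile> \<psi>[x//Const c]" using * mp by blast
  then show "\<exists>t\<in>CTer \<Theta>. \<turnstile> \<psi>[x//t]" using c(1) by (intro bexI[of _ "Const c"]) (auto simp: CTer_def)
qed

lemma derives_variant:
  assumes "variant \<alpha> \<beta>" "\<alpha> \<in> For \<Theta>" "\<beta> \<in> For \<Theta>"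
  shows "\<turnstile> \<alpha> \<longleftrightarrow> \<turnstile> \<beta>"
  using assms variant_imp mp variant.sym by blast

end


section \<open>Henkin constants\<close>

text \<open>A witness for a formula is named by the formula itself, which may contain such constants.\<close>

datatype ('c, 'f, 'p) hc =
  Orig 'c | Wit quant nat "(('c, 'f, 'p) hc, 'f, 'p) fm"

text \<open>The datatype has witnesses for arbitrary syntax trees; this selects the hereditarily
  well-formed ones. The intended premise that \<open>\<psi>\<close> is a formula of the Henkin
  language would be circular, as that language is built from this predicate. It is split into a
  condition on shape, with all constants allowed, and one on the constants;
  \<open>hconst_Wit\<close> puts the two together again.\<close>

inductive hconst :: "('c, 'f, 'p) fo_signature \<Rightarrow> ('c, 'f, 'p) hc \<Rightarrow> bool"
  for \<Theta> :: "('c, 'f, 'p) fo_signature" where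
  "c \<in> sig_consts \<Theta> \<Longrightarrow> hconst \<Theta> (Orig c)"
| "\<lbrakk>\<psi> \<in> For \<lparr>sig_consts = UNIV, sig_funs = sig_funs \<Theta>, sig_preds = sig_preds \<Theta>\<rparr>;
    \<forall>c\<in>set1_fm \<psi>. hconst \<Theta> c\<rbrakk> \<Longrightarrow> hconst \<Theta> (Wit Q x \<psi>)"

definition henkin_sig :: "('c, 'f, 'p) fo_signature \<Rightarrow> (('c, 'f, 'p) hc, 'f, 'p) fo_signature" where
  "henkin_sig \<Theta> = \<lparr>sig_consts = Collect (hconst \<Theta>), sig_funs = sig_funs \<Theta>, sig_preds = sig_preds \<Theta>\<rparr>"

lemma henkin_sig_sel [simp]:
  "sig_consts (henkin_sig \<Theta>) = Collect (hconst \<Theta>)"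
  "sig_funs (henkin_sig \<Theta>) = sig_funs \<Theta>"
  "sig_preds (henkin_sig \<Theta>) = sig_preds \<Theta>"
  by (simp_all add: henkin_sig_def)

lemma Ter_consts_UNIV:
  "t \<in> Ter (\<Theta>\<lparr>sig_consts := UNIV\<rparr>) \<and> set1_tm t \<subseteq> sig_consts \<Theta> \<longleftrightarrow> t \<in> Ter \<Theta>"
  by (induction t) (auto simp: subset_iff)

lemma For_consts_UNIV:
  "\<phi> \<in> For (\<Theta>\<lparr>sig_consts := UNIV\<rparr>) \<and> set1_fm \<phi> \<subseteq> sig_consts \<Theta> \<longleftrightarrow> \<phi> \<in> For \<Theta>"
proof (induction \<phi>)
  case (Pred P ts)
  then show ?case using Ter_consts_UNIV[of _ \<Theta>] by auto
qed auto

lemma hconst_Wit: "hconst \<Theta> (Wit Q x \<psi>) \<longleftrightarrow> \<psi> \<in> For (henkin_sig \<Theta>)"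
  using For_consts_UNIV[of \<psi> "henkin_sig \<Theta>"]
  by (auto simp: henkin_sig_def intro: hconst.intros elim: hconst.cases)

lemma hconst_Orig [simp]: "hconst \<Theta> (Orig c) \<longleftrightarrow> c \<in> sig_consts \<Theta>"
  by (auto intro: hconst.intros elim: hconst.cases)

text \<open>\<open>Sup\<close> is a maximum here, since a formula has finitely many constants; the
  detour over \<open>map_fm\<close> is how recursion passes through the nesting of \<open>hc\<close>
  in \<open>fm\<close>.\<close>

primrec hc_depth :: "('c, 'f, 'p) hc \<Rightarrow> nat" where
  "hc_depth (Orig c) = 0"
| "hc_depth (Wit Q x \<psi>) = Suc (Sup (set1_fm (map_fm hc_depth (\<lambda>f. f) (\<lambda>p. p) \<psi>)))"

lemma finite_set1_tm: "finite (set1_tm t)"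
  by (induction t) auto

lemma finite_set1_fm: "finite (set1_fm \<phi>)"
  by (induction \<phi>) (auto simp: finite_set1_tm)

lemma hc_depth_less: "c \<in> set1_fm \<psi> \<Longrightarrow> hc_depth c < hc_depth (Wit Q x \<psi>)"
  by (auto simp: fm.set_map less_Suc_eq_le finite_set1_fm intro!: cSup_upper bdd_above_finite)

lemma set1_tm_inst: "set1_tm (tm_inst \<sigma> t) \<subseteq> set1_tm t \<union> (\<Union>x. set1_tm (\<sigma> x))"
  by (induction t) auto

lemma set1_fm_inst: "set1_fm (fm_inst \<sigma> \<phi>) \<subseteq> set1_fm \<phi> \<union> (\<Union>x. set1_tm (\<sigma> x))"
proof (induction \<phi> arbitrary: \<sigma>)
  case (Pred P ts)
  have "(\<Union>t\<in>set ts. set1_tm (tm_inst \<sigma> t)) \<subseteq> (\<Union>t\<in>set ts. set1_tm t) \<union> (\<Union>x. set1_tm (\<sigma> x))"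
    using set1_tm_inst[of \<sigma>] by blast
  then show ?case by simp
next
  case (Quant Q x \<phi>)
  have "(\<Union>y. set1_tm ((\<sigma>(x := Var x)) y)) \<subseteq> (\<Union>y. set1_tm (\<sigma> y))"
    by (auto split: if_splits)
  with Quant.IH[of "\<sigma>(x := Var x)"]
  have "set1_fm (fm_inst (\<sigma>(x := Var x)) \<phi>) \<subseteq> set1_fm \<phi> \<union> (\<Union>y. set1_tm (\<sigma> y))"
    by (rule order_trans[OF _ Un_mono[OF order_refl]])
  then show ?case by simp
next
  case (Binary b \<phi> \<psi>)
  show ?case using Binary.IH(1)[of \<sigma>] Binary.IH(2)[of \<sigma>] by auto
next
  case (Unary u \<phi>)
  show ?case using Unary.IH[of \<sigma>] by simp
qed

lemma set1_henkin_ax: "set1_fm (henkin_ax Q x \<psi> c) \<subseteq> insert c (set1_fm \<psi>)"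
proof -
  have "(\<Union>y. set1_tm ((Var(x := Const c)) y)) \<subseteq> {c}" by (auto split: if_splits)
  then have "set1_fm (\<psi>[x//Const c]) \<subseteq> insert c (set1_fm \<psi>)"
    using set1_fm_inst[of "Var(x := Const c)" \<psi>] unfolding subst_def by blast
  then show ?thesis by (cases Q) auto
qed

section \<open>Conservativity of the Henkin extension\<close>

definition orig :: "('c, 'f, 'p) fm \<Rightarrow> (('c, 'f, 'p) hc, 'f, 'p) fm" where
  "orig = fm_csub (\<lambda>c. Const (Orig c))"

lemma orig_For: "\<phi> \<in> For \<Theta> \<Longrightarrow> orig \<phi> \<in> For (henkin_sig \<Theta>)"
  unfolding orig_def by (rule fm_csub_For) auto

lemma set1_orig: "set1_fm (orig \<phi>) \<subseteq> range Orig"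
  by (auto simp: orig_def fm.set_map simp flip: map_fm_csub)

definition henkin_axs :: "('c, 'f, 'p) fo_signature \<Rightarrow> (('c, 'f, 'p) hc, 'f, 'p) fm set" where
  "henkin_axs \<Theta> = {henkin_ax Q x \<psi> (Wit Q x \<psi>) | Q x \<psi>. Quant Q x \<psi> \<in> Sen (henkin_sig \<Theta>)}"

lemma henkin_axs_Sen: "henkin_axs \<Theta> \<subseteq> Sen (henkin_sig \<Theta>)"
  by (auto simp: henkin_axs_def hconst_Wit intro!: henkin_ax_Sen) (auto simp: Sen_def)

text \<open>Henkin axioms are removed by decreasing depth of their constants: a constant of
  maximal depth occurs in no other axiom.\<close>

lemma drop_henkin_axs:
  assumes \<Gamma>: "\<Gamma> \<subseteq> For \<Theta>"
    and d: "qmbc_derivable (henkin_sig \<Theta>) (orig ` \<Gamma> \<union> henkin_axs \<Theta>) (orig \<phi>)"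
  shows "qmbc_derivable (henkin_sig \<Theta>) (orig ` \<Gamma>) (orig \<phi>)"
proof -
  \<comment> \<open>Indexing the axioms by triples makes distinct indices have distinct witness
    constants, by injectivity of \<open>Wit\<close>.\<close>
  define h where "h = (\<lambda>(Q, x, \<psi> :: (('a, 'b, 'c) hc, 'b, 'c) fm). henkin_ax Q x \<psi> (Wit Q x \<psi>))"
  define A where "A = {(Q, x, \<psi>). Quant Q x \<psi> \<in> Sen (henkin_sig \<Theta>)}"
  have H: "henkin_axs \<Theta> = h ` A" by (auto simp: henkin_axs_def h_def A_def image_iff) blast
  obtain \<Delta> where \<Delta>: "finite \<Delta>" "\<Delta> \<subseteq> orig ` \<Gamma> \<union> henkin_axs \<Theta>"
    "qmbc_derivable (henkin_sig \<Theta>) \<Delta> (orig \<phi>)"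
    using derivable_compact[OF d] by blast
  have "finite (\<Delta> - orig ` \<Gamma>)" "\<Delta> - orig ` \<Gamma> \<subseteq> h ` A"
    using \<Delta>(1,2) unfolding H by auto
  from finite_subset_image[OF this]
  obtain T where T: "finite T" "T \<subseteq> A" "\<Delta> - orig ` \<Gamma> = h ` T"
    by blast
  then have "\<Delta> \<subseteq> orig ` \<Gamma> \<union> h ` T" by blast
  with \<Delta>(3) have "qmbc_derivable (henkin_sig \<Theta>) (orig ` \<Gamma> \<union> h ` T) (orig \<phi>)"
    by (rule derivable_mono)
  with T(1,2) show ?thesis
  \<comment> \<open>Elements are inserted in order of increasing depth, so the inserted index is the
    deepest: its axiom is removed first.\<close>
  proof (induction T rule: finite_ranking_induct[where f = "\<lambda>(Q, x, \<psi>). hc_depth (Wit Q x \<psi>)"])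
    case empty
    then show ?case by simp
  next
    case (insert p T)
    obtain Q x \<psi> where p: "p = (Q, x, \<psi>)" by (cases p)
    let ?c = "Wit Q x \<psi>"
    have c: "?c \<notin> set1_fm \<psi>" using hc_depth_less[of ?c \<psi> Q x] by auto
    show ?case
    \<comment> \<open>The ranking induction does not exclude that \<open>p\<close> is already
      present.\<close>
    proof (cases "p \<in> T")
      case True
      then show ?thesis using insert by (simp add: insert_absorb)
    next
      case False
      have "qmbc_derivable (henkin_sig \<Theta>) (orig ` \<Gamma> \<union> h ` T) (orig \<phi>)"
      proof (rule drop_henkin_ax[OF _ _ _ _ c])
        show "qmbc_derivable (henkin_sig \<Theta>) (insert (henkin_ax Q x \<psi> ?c) (orig ` \<Gamma> \<union> h ` T)) (orig \<phi>)"
          using insert.prems(2) p by (simp add: h_def)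
        show "orig ` \<Gamma> \<union> h ` T \<subseteq> For (henkin_sig \<Theta>)"
        proof -
          have "h ` T \<subseteq> Sen (henkin_sig \<Theta>)"
            using insert.prems(1) henkin_axs_Sen[of \<Theta>] unfolding H by blast
          then show ?thesis using \<Gamma> by (auto simp: Sen_def orig_For)
        qed
        show "Quant Q x \<psi> \<in> Sen (henkin_sig \<Theta>)" using insert.prems(1) p by (simp add: A_def)
        then show "?c \<in> sig_consts (henkin_sig \<Theta>)" by (simp add: hconst_Wit Sen_def)
        show "?c \<notin> set1_fm (orig \<phi>)" using set1_orig[of \<phi>] by auto
        fix \<gamma> assume "\<gamma> \<in> orig ` \<Gamma> \<union> h ` T"
        then show "?c \<notin> set1_fm \<gamma>"
        proof
          assume "\<gamma> \<in> orig ` \<Gamma>"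
          then show ?thesis using set1_orig by blast
        next
          assume "\<gamma> \<in> h ` T"
          then obtain Q' x' \<psi>' where q: "(Q', x', \<psi>') \<in> T" "\<gamma> = henkin_ax Q' x' \<psi>' (Wit Q' x' \<psi>')"
            by (auto simp: h_def)
          then have "?c \<noteq> Wit Q' x' \<psi>'" using False p by auto
          \<comment> \<open>Were \<open>?c\<close> to occur in \<open>\<psi>'\<close>, it would lie
            strictly below the witness of \<open>\<psi>'\<close>, which is at most as deep as
            \<open>?c\<close>. Ties in depth are therefore harmless.\<close>
          moreover have "hc_depth (Wit Q' x' \<psi>') \<le> hc_depth ?c"
            using insert.hyps(2)[OF q(1)] p by simp
          then have "?c \<notin> set1_fm \<psi>'" using hc_depth_less[of ?c \<psi>' Q' x'] by auto
          ultimately show ?thesis using set1_henkin_ax[of Q' x' \<psi>' "Wit Q' x' \<psi>'"] q(2) by blast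
        qed
      qed
      then show ?thesis using insert by simp
    qed
  qed
qed

text \<open>Without the axioms a derivation may still mention witness constants. All of them are
  sent to one variable fresh for the derivation, while images under \<open>orig\<close> return to
  their originals.\<close>

lemma henkin_conservative:
  fixes \<Gamma> :: "('c, 'f, 'p) fm set"
  assumes \<Gamma>: "\<Gamma> \<subseteq> For \<Theta>"
    and d: "qmbc_derivable (henkin_sig \<Theta>) (orig ` \<Gamma> \<union> henkin_axs \<Theta>) (orig \<phi>)"
  shows "qmbc_derivable \<Theta> \<Gamma> \<phi>"
proof -
  let ?\<kappa> = "\<lambda>y. case_hc Const (\<lambda>_ _ _. Var y)"
  have "\<forall>\<^sub>F y in cofinite. qmbc_derivable \<Theta> (fm_csub (?\<kappa> y) ` orig ` \<Gamma>) (fm_csub (?\<kappa> y) (orig \<phi>))"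
    by (rule derivable_csub[OF drop_henkin_axs[OF assms]])
      (auto simp: crange_def split: hc.splits)
  then obtain y where "qmbc_derivable \<Theta> (fm_csub (?\<kappa> y) ` orig ` \<Gamma>) (fm_csub (?\<kappa> y) (orig \<phi>))"
    using eventually_happens'[of "cofinite :: nat filter"] by auto
  moreover have "fm_csub (?\<kappa> y) (orig \<chi>) = \<chi>" for \<chi> :: "('c, 'f, 'p) fm"
    by (simp add: orig_def fm_csub_csub)
  ultimately show ?thesis by (simp add: image_comp comp_def)
qed

lemma henkin_theory:
  assumes \<Gamma>: "\<Gamma> \<subseteq> For \<Theta>" and "\<not> qmbc_derivable \<Theta> \<Gamma> \<phi>"
  obtains \<Delta> where "saturated (henkin_sig \<Theta>) \<Delta> (orig \<phi>)" "orig ` \<Gamma> \<subseteq> \<Delta>"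
proof -
  let ?\<Gamma> = "orig ` \<Gamma> \<union> henkin_axs \<Theta>"
  have "\<not> qmbc_derivable (henkin_sig \<Theta>) ?\<Gamma> (orig \<phi>)"
    using henkin_conservative[OF \<Gamma>] assms(2) by blast
  then obtain S where S: "S \<subseteq> Sen (henkin_sig \<Theta>)"
    "\<not> qmbc_derivable (henkin_sig \<Theta>) (?\<Gamma> \<union> S) (orig \<phi>)"
    "\<And>\<alpha>. \<alpha> \<in> Sen (henkin_sig \<Theta>) \<Longrightarrow> \<alpha> \<notin> S \<Longrightarrow> qmbc_derivable (henkin_sig \<Theta>) (insert \<alpha> (?\<Gamma> \<union> S)) (orig \<phi>)"
    by (rule lindenbaum) (rule that)
  have F: "?\<Gamma> \<union> S \<subseteq> For (henkin_sig \<Theta>)"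
    using \<Gamma> S(1) henkin_axs_Sen[of \<Theta>] by (auto simp: Sen_def orig_For)
  interpret hypotheses "henkin_sig \<Theta>" "?\<Gamma> \<union> S" by unfold_locales fact
  have "saturated (henkin_sig \<Theta>) (?\<Gamma> \<union> S) (orig \<phi>)"
  proof
    show "\<not> qmbc_derivable (henkin_sig \<Theta>) (?\<Gamma> \<union> S) (orig \<phi>)" by fact
    show "qmbc_derivable (henkin_sig \<Theta>) (?\<Gamma> \<union> S) (\<alpha> \<^bold>\<rightarrow> orig \<phi>)" if "\<alpha> \<in> Sen (henkin_sig \<Theta>)" "\<not> qmbc_derivable (henkin_sig \<Theta>) (?\<Gamma> \<union> S) \<alpha>" for \<alpha>
    proof (intro deduction S(3))
      show "\<alpha> \<notin> S" using that(2) by (auto intro: qmbc_derivable.Premise)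
    qed fact+
    show "\<exists>c\<in>sig_consts (henkin_sig \<Theta>). qmbc_derivable (henkin_sig \<Theta>) (?\<Gamma> \<union> S) (henkin_ax Q x \<psi> c)" if "Quant Q x \<psi> \<in> Sen (henkin_sig \<Theta>)" for Q x \<psi>
    proof (intro bexI[of _ "Wit Q x \<psi>"])
      show "qmbc_derivable (henkin_sig \<Theta>) (?\<Gamma> \<union> S) (henkin_ax Q x \<psi> (Wit Q x \<psi>))"
        using that by (intro qmbc_derivable.Premise) (auto simp: henkin_axs_def)
      show "Wit Q x \<psi> \<in> sig_consts (henkin_sig \<Theta>)"
        using that by (simp add: hconst_Wit Sen_def)
    qed
  qed
  then show ?thesis by (rule that) auto
qed


section \<open>Cardinality of the Henkin language\<close>

text \<open>\<open>J n a b\<close> is a pairing tagged by \<open>n\<close>, with \<open>a0\<close>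
  as a filler. The symbol codes are injective on the signature only, as the types behind it may be
  much larger than \<open>A\<close>.\<close>

locale coding =
  fixes \<Theta> :: "('c, 'f, 'p) fo_signature"
    and A :: "'x set" and a0 :: 'x and J :: "nat \<Rightarrow> 'x \<Rightarrow> 'x \<Rightarrow> 'x"
    and sc :: "'c \<Rightarrow> 'x" and sf :: "'f \<Rightarrow> 'x" and sp :: "'p \<Rightarrow> 'x"
  assumes a0 [simp]: "a0 \<in> A"
    and J_in [simp]: "a \<in> A \<Longrightarrow> b \<in> A \<Longrightarrow> J n a b \<in> A"
    and J_inj: "\<lbrakk>a \<in> A; b \<in> A; a' \<in> A; b' \<in> A; J n a b = J n' a' b'\<rbrakk> \<Longrightarrow> n = n' \<and> a = a' \<and> b = b'"
    and sc_in [simp]: "sc c \<in> A" and sc_inj: "inj_on sc (sig_consts \<Theta>)"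
    and sf_in [simp]: "sf f \<in> A" and sf_inj: "inj_on sf (\<Union>n\<in>{1..}. sig_funs \<Theta> n)"
    and sp_in [simp]: "sp P \<in> A" and sp_inj: "inj_on sp (\<Union>n\<in>{1..}. sig_preds \<Theta> n)"
begin

lemma J_eq:
  "\<lbrakk>a \<in> A; b \<in> A; a' \<in> A; b' \<in> A\<rbrakk> \<Longrightarrow> J n a b = J n' a' b' \<longleftrightarrow> n = n' \<and> a = a' \<and> b = b'"
  using J_inj by blast

primrec code_list :: "'x list \<Rightarrow> 'x" where
  "code_list [] = J 0 a0 a0"
| "code_list (x # xs) = J 1 x (code_list xs)"

lemma code_list_in [simp]: "set xs \<subseteq> A \<Longrightarrow> code_list xs \<in> A"
  by (induction xs) auto

lemma code_list_inj:
  "set xs \<subseteq> A \<Longrightarrow> set ys \<subseteq> A \<Longrightarrow> code_list xs = code_list ys \<Longrightarrow> xs = ys"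
proof (induction xs arbitrary: ys)
  case Nil
  show ?case
  proof (cases ys)
    case (Cons y zs)
    then show ?thesis using Nil.prems(2,3) J_inj[of a0 a0 y "code_list zs" 0 1] by simp
  qed simp
next
  case (Cons x xs)
  show ?case
  proof (cases ys)
    case Nil
    then show ?thesis using Cons.prems(1,3) J_inj[of x "code_list xs" a0 a0 1 0] by simp
  next
    case (Cons y zs)
    then show ?thesis
      using Cons.prems Cons.IH[of zs] J_inj[of x "code_list xs" y "code_list zs" 1 1] by simp
  qed
qed

text \<open>Tags 0 and 1 belong to the other two constructors, hence the offset 2 for
  variables.\<close>

fun code_tm :: "('k \<Rightarrow> 'x) \<Rightarrow> ('k, 'f) tm \<Rightarrow> 'x" where
  "code_tm g (Var x) = J (x + 2) a0 a0"
| "code_tm g (Const c) = J 0 (g c) a0"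
| "code_tm g (Fun f ts) = J 1 (sf f) (code_list (map (code_tm g) ts))"

text \<open>The connectives and atoms take the tags below 6. From there on, parity separates the
  quantifiers and the rest of the tag holds the bound variable.\<close>

fun code_fm :: "('k \<Rightarrow> 'x) \<Rightarrow> ('k, 'f, 'p) fm \<Rightarrow> 'x" where
  "code_fm g (Pred P ts) = J 0 (sp P) (code_list (map (code_tm g) ts))"
| "code_fm g (Binary b \<phi> \<psi>) =
     J (case b of And \<Rightarrow> 1 | Or \<Rightarrow> 2 | Imp \<Rightarrow> 3) (code_fm g \<phi>) (code_fm g \<psi>)"
| "code_fm g (Unary u \<phi>) = J (case u of Neg \<Rightarrow> 4 | Circ \<Rightarrow> 5) (code_fm g \<phi>) a0"
| "code_fm g (Quant Q x \<phi>) =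
     J (2 * x + (case Q of Forall \<Rightarrow> 6 | Exists \<Rightarrow> 7)) (code_fm g \<phi>) a0"

text \<open>The constants inside \<open>\<psi>\<close> are first replaced by their codes, then the
  formula is coded with codes as constants; \<open>code_fm_map\<close> fuses both passes into
  \<open>code_fm code_hc \<psi>\<close>.\<close>

primrec code_hc :: "('c, 'f, 'p) hc \<Rightarrow> 'x" where
  "code_hc (Orig c) = J 0 (sc c) a0"
| "code_hc (Wit Q x \<psi>) = J (2 * x + (case Q of Forall \<Rightarrow> 1 | Exists \<Rightarrow> 2))
     (code_fm (\<lambda>a. a) (map_fm code_hc (\<lambda>f. f) (\<lambda>p. p) \<psi>)) a0"

lemma code_tm_map: "code_tm g (map_tm h (\<lambda>f. f) t) = code_tm (\<lambda>c. g (h c)) t"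
  by (induction t) (auto simp: comp_def cong: map_cong)

lemma code_fm_map: "code_fm g (map_fm h (\<lambda>f. f) (\<lambda>p. p) \<phi>) = code_fm (\<lambda>c. g (h c)) \<phi>"
  by (induction \<phi>) (auto simp: comp_def code_tm_map)

lemma mem_UN_arity: "f \<in> S (length ts) \<Longrightarrow> ts \<noteq> [] \<Longrightarrow> f \<in> (\<Union>n\<in>{1..}. S n)"
  by (auto simp: Suc_le_eq intro!: bexI[of _ "length ts"])

lemma code_tm_in: "(\<And>c. c \<in> set1_tm t \<Longrightarrow> g c \<in> A) \<Longrightarrow> code_tm g t \<in> A"
proof (induction t)
  case (Fun f ts)
  then have "set (map (code_tm g) ts) \<subseteq> A" by auto
  then show ?case by simp
qed auto

lemma code_fm_in: "(\<And>c. c \<in> set1_fm \<phi> \<Longrightarrow> g c \<in> A) \<Longrightarrow> code_fm g \<phi> \<in> A"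
proof (induction \<phi>)
  case (Pred P ts)
  then have "set (map (code_tm g) ts) \<subseteq> A" by (auto intro: code_tm_in)
  then show ?case by simp
qed auto

lemma code_hc_in [simp]: "code_hc c \<in> A"
  by (induction c) (auto simp: code_fm_map intro!: code_fm_in J_in)

context
  fixes \<Theta>' :: "('k, 'f, 'p) fo_signature" and g :: "'k \<Rightarrow> 'x"
  assumes funs: "sig_funs \<Theta>' = sig_funs \<Theta>" and preds: "sig_preds \<Theta>' = sig_preds \<Theta>"
    and g_in: "\<And>c. g c \<in> A"
begin

lemma codes_in [simp]:
  "code_tm g t \<in> A" "code_fm g \<phi> \<in> A" "code_list (map (code_tm g) ts) \<in> A" "g c \<in> A"
proof -
  show tm: "code_tm g t \<in> A" for t using g_in by (intro code_tm_in)
  show "code_fm g \<phi> \<in> A" using g_in by (intro code_fm_in)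
  show "code_list (map (code_tm g) ts) \<in> A" using tm by (intro code_list_in) auto
  show "g c \<in> A" by (rule g_in)
qed

text \<open>Injectivity of \<open>g\<close> is asked just at the constants of \<open>t\<close>,
  against all constants of the language. This is the form in which the induction hypothesis of
  \<open>code_hc_inj\<close> provides it, where the constants of a formula are smaller than its
  witness.\<close>

lemma code_tm_inj:
  assumes "t \<in> Ter \<Theta>'" "s \<in> Ter \<Theta>'" "code_tm g t = code_tm g s"
    and "\<And>c c'. c \<in> set1_tm t \<Longrightarrow> c' \<in> sig_consts \<Theta>' \<Longrightarrow> g c = g c' \<Longrightarrow> c = c'"
  shows "t = s"
  using assms
proof (induction t arbitrary: s rule: tm.induct)
  case (Var x)
  then show ?case by (cases s) (simp_all add: J_eq)
next
  case (Const c)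
  then show ?case by (cases s) (simp_all add: J_eq)
next
  case (Fun f ts)
  show ?case
  proof (cases s)
    case s: (Fun f' ts')
    have ts: "set ts \<subseteq> Ter \<Theta>'" "set ts' \<subseteq> Ter \<Theta>'" using Fun.prems(1,2) s by auto
    have *: "sf f = sf f'" "code_list (map (code_tm g) ts) = code_list (map (code_tm g) ts')"
      using Fun.prems(3) s by (simp_all add: J_eq)
    have "map (code_tm g) ts = map (code_tm g) ts'"
      using *(2) by (intro code_list_inj) auto
    then have "ts = ts'"
    proof (rule list.inj_map_strong[rotated])
      fix t t' assume "t \<in> set ts" "t' \<in> set ts'" "code_tm g t = code_tm g t'"
      then show "t = t'" using Fun.prems(4) ts by (intro Fun.IH) auto
    qed
    moreover have "f = f'"
      using Fun.prems(1,2) s funs by (intro inj_onD[OF sf_inj *(1)] mem_UN_arity) auto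
    ultimately show ?thesis using s by simp
  qed (use Fun.prems(3) in \<open>simp_all add: J_eq\<close>)
qed

lemma code_fm_inj:
  assumes "\<phi> \<in> For \<Theta>'" "\<psi> \<in> For \<Theta>'" "code_fm g \<phi> = code_fm g \<psi>"
    and "\<And>c c'. c \<in> set1_fm \<phi> \<Longrightarrow> c' \<in> sig_consts \<Theta>' \<Longrightarrow> g c = g c' \<Longrightarrow> c = c'"
  shows "\<phi> = \<psi>"
  using assms
proof (induction \<phi> arbitrary: \<psi> rule: fm.induct)
  case (Pred P ts)
  show ?case
  proof (cases \<psi>)
    case s: (Pred P' ts')
    have ts: "set ts \<subseteq> Ter \<Theta>'" "set ts' \<subseteq> Ter \<Theta>'" using Pred.prems(1,2) s by auto
    have *: "sp P = sp P'" "code_list (map (code_tm g) ts) = code_list (map (code_tm g) ts')"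
      using Pred.prems(3) s by (simp_all add: J_eq)
    have "map (code_tm g) ts = map (code_tm g) ts'"
      using *(2) by (intro code_list_inj) auto
    then have "ts = ts'"
    proof (rule list.inj_map_strong[rotated])
      fix t t' assume "t \<in> set ts" "t' \<in> set ts'" "code_tm g t = code_tm g t'"
      then show "t = t'" using Pred.prems(4) ts by (intro code_tm_inj[of t t']) auto
    qed
    moreover have "P = P'"
      using Pred.prems(1,2) s preds by (intro inj_onD[OF sp_inj *(1)] mem_UN_arity) auto
    ultimately show ?thesis using s by simp
  qed (use Pred.prems(3) in \<open>simp_all add: J_eq split: binop.splits unop.splits quant.splits\<close>)
next
  case (Binary b \<phi> \<chi>)
  show ?case
  proof (cases \<psi>)
    case s: (Binary b' \<phi>' \<chi>')
    then have *: "code_fm g \<phi> = code_fm g \<phi>'" "code_fm g \<chi> = code_fm g \<chi>'" and "b = b'"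
      using Binary.prems(3) by (simp_all add: J_eq split: binop.splits)
    have "\<phi> = \<phi>'" "\<chi> = \<chi>'"
      using s Binary.prems(1,2,4) * by (auto intro!: Binary.IH)
    then show ?thesis using s \<open>b = b'\<close> by simp
  qed (use Binary.prems(3) in \<open>simp_all add: J_eq split: binop.splits unop.splits quant.splits\<close>)
next
  case (Unary u \<phi>)
  show ?case
  proof (cases \<psi>)
    case s: (Unary u' \<phi>')
    then have *: "code_fm g \<phi> = code_fm g \<phi>'" and "u = u'"
      using Unary.prems(3) by (simp_all add: J_eq split: unop.splits)
    have "\<phi> = \<phi>'" using s Unary.prems(1,2,4) * by (intro Unary.IH) auto
    then show ?thesis using s \<open>u = u'\<close> by simp
  qed (use Unary.prems(3) in \<open>simp_all add: J_eq split: binop.splits unop.splits quant.splits\<close>)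
next
  case (Quant Q x \<phi>)
  show ?case
  proof (cases \<psi>)
    case s: (Quant Q' x' \<phi>')
    then have *: "2 * x + (case Q of Forall \<Rightarrow> 6 | Exists \<Rightarrow> 7) = 2 * x' + (case Q' of Forall \<Rightarrow> 6 | Exists \<Rightarrow> 7)"
      "code_fm g \<phi> = code_fm g \<phi>'"
      using Quant.prems(3) by (simp_all add: J_eq)
    have "Q = Q' \<and> x = x'" using *(1) by (cases Q; cases Q') (simp_all, presburger+)
    moreover have "\<phi> = \<phi>'" using s Quant.prems(1,2,4) * by (intro Quant.IH) auto
    ultimately show ?thesis using s by simp
  qed (use Quant.prems(3) in \<open>simp_all add: J_eq split: binop.splits unop.splits quant.splits\<close>)
qed

end

lemma code_hc_inj: "hconst \<Theta> c \<Longrightarrow> hconst \<Theta> c' \<Longrightarrow> code_hc c = code_hc c' \<Longrightarrow> c = c'"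
proof (induction c arbitrary: c' rule: hconst.induct)
  case (1 c)
  then show ?case
    by (cases c') (auto simp: J_eq code_fm_map code_fm_in dest: inj_onD[OF sc_inj] split: quant.splits)
next
  case (2 \<psi> Q x)
  show ?case
  proof (cases c')
    case (Orig b)
    then show ?thesis using 2(4) by (auto simp: J_eq code_fm_map code_fm_in split: quant.splits)
  next
    case (Wit Q' x' \<psi>')
    then have *: "2 * x + (case Q of Forall \<Rightarrow> 1 | Exists \<Rightarrow> 2) = 2 * x' + (case Q' of Forall \<Rightarrow> 1 | Exists \<Rightarrow> 2)"
      "code_fm code_hc \<psi> = code_fm code_hc \<psi>'"
      using 2(4) by (simp_all add: J_eq code_fm_map code_fm_in)
    have "\<psi> \<in> For (henkin_sig \<Theta>)" "\<psi>' \<in> For (henkin_sig \<Theta>)"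
      using 2(1-3) hconst.intros(2)[of \<psi> \<Theta> Q x] Wit by (simp_all add: hconst_Wit)
    then have "\<psi> = \<psi>'"
      by (rule code_fm_inj[of "henkin_sig \<Theta>" code_hc, rotated 3]) (use *(2) 2(2) in auto)
    moreover have "Q = Q' \<and> x = x'" using *(1) by (cases Q; cases Q') (simp_all, presburger+)
    ultimately show ?thesis using Wit by simp
  qed
qed

lemma Ter_lepoll: "Ter (henkin_sig \<Theta>) \<lesssim> A"
  unfolding lepoll_def
proof (intro exI conjI)
  show "code_tm code_hc ` Ter (henkin_sig \<Theta>) \<subseteq> A"
    by (auto intro: code_tm_in)
  show "inj_on (code_tm code_hc) (Ter (henkin_sig \<Theta>))"
  proof
    fix t s assume ts: "t \<in> Ter (henkin_sig \<Theta>)" "s \<in> Ter (henkin_sig \<Theta>)"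
      "code_tm code_hc t = code_tm code_hc s"
    have "set1_tm t \<subseteq> Collect (hconst \<Theta>)" using Ter_consts_UNIV[of t "henkin_sig \<Theta>"] ts(1) by simp
    then show "t = s"
      using ts by (intro code_tm_inj[of "henkin_sig \<Theta>" code_hc]) (auto intro: code_hc_inj)
  qed
qed

end

text \<open>One predicate symbol gives an atom for each variable, so \<open>For \<Theta>\<close> is
  infinite and absorbs its own square and a numerical tag; this yields the pairing. Symbols are
  coded by formulas in which they can be recognized.\<close>

lemma henkin_terms_lepoll:
  fixes \<Theta> :: "('c, 'f, 'p) fo_signature"
  assumes "is_signature \<Theta>"
  shows "Ter (henkin_sig \<Theta>) \<lesssim> For \<Theta>"
proof -
  obtain n P where n: "n \<ge> 1" "P \<in> sig_preds \<Theta> n" using assms by (auto simp: is_signature_def)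
  define atom where "atom = (\<lambda>t. Pred P (replicate n t) :: ('c, 'f, 'p) fm)"
  have atom_For: "atom t \<in> For \<Theta>" if "t \<in> Ter \<Theta>" for t
    using n that by (auto simp: atom_def)
  have atom_inj: "atom t = atom s \<Longrightarrow> t = s" for t s
    using n by (cases n) (auto simp: atom_def)
  have "inj (\<lambda>x. atom (Var x))" using atom_inj by (auto intro: injI)
  moreover have "range (\<lambda>x. atom (Var x)) \<subseteq> For \<Theta>" by (auto intro: atom_For)
  ultimately have inf: "infinite (For \<Theta>)" unfolding infinite_iff_countable_subset by blast
  then have nat: "(UNIV :: nat set) \<lesssim> For \<Theta>" by (simp add: infinite_le_lepoll)
  have sq: "For \<Theta> \<times> For \<Theta> \<lesssim> For \<Theta>"
    using card_of_Times_same_infinite[OF inf] by (simp add: eqpoll_iff_card_of_ordIso[symmetric] eqpoll_imp_lepoll)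
  have "(UNIV :: nat set) \<times> (For \<Theta> \<times> For \<Theta>) \<lesssim> For \<Theta> \<times> For \<Theta>"
    using nat sq by (rule times_lepoll_mono)
  then have "(UNIV :: nat set) \<times> (For \<Theta> \<times> For \<Theta>) \<lesssim> For \<Theta>"
    using sq by (rule lepoll_trans)
  then obtain j where j: "inj_on j ((UNIV :: nat set) \<times> (For \<Theta> \<times> For \<Theta>)) \<and>
    j ` ((UNIV :: nat set) \<times> (For \<Theta> \<times> For \<Theta>)) \<subseteq> For \<Theta>"
    unfolding lepoll_def by (elim exE)
  have "\<exists>sf :: 'f \<Rightarrow> ('c, 'f, 'p) fm. (\<forall>f. sf f \<in> For \<Theta>) \<and> inj_on sf (\<Union>n\<in>{1..}. sig_funs \<Theta> n)"
  proof -
    \<comment> \<open>A symbol may belong to several arities; one of them is chosen.\<close>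
    define ar where "ar = (\<lambda>f. SOME k. k \<ge> 1 \<and> f \<in> sig_funs \<Theta> k)"
    define F where "F = (\<Union>n\<in>{1..}. sig_funs \<Theta> n)"
    let ?sf = "\<lambda>f. atom (if f \<in> F then Fun f (replicate (ar f) (Var 0)) else Var 0)"
    have "ar f \<ge> 1 \<and> f \<in> sig_funs \<Theta> (ar f)" if "f \<in> F" for f
      unfolding ar_def by (rule someI_ex) (use that in \<open>auto simp: F_def\<close>)
    then have "?sf f \<in> For \<Theta>" for f by (intro atom_For) (cases "f \<in> F"; force)
    moreover have "inj_on ?sf F" by (auto intro!: inj_onI dest!: atom_inj)
    ultimately show ?thesis unfolding F_def[symmetric] by (intro exI[of _ ?sf]) simp
  qed
  then obtain sf :: "'f \<Rightarrow> ('c, 'f, 'p) fm"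
    where sf: "\<And>f. sf f \<in> For \<Theta>" "inj_on sf (\<Union>n\<in>{1..}. sig_funs \<Theta> n)"
    by blast
  have "\<exists>sp :: 'p \<Rightarrow> ('c, 'f, 'p) fm. (\<forall>P. sp P \<in> For \<Theta>) \<and> inj_on sp (\<Union>n\<in>{1..}. sig_preds \<Theta> n)"
  proof -
    define ar where "ar = (\<lambda>P. SOME k. k \<ge> 1 \<and> P \<in> sig_preds \<Theta> k)"
    define F where "F = (\<Union>n\<in>{1..}. sig_preds \<Theta> n)"
    let ?sp = "\<lambda>P. if P \<in> F then Pred P (replicate (ar P) (Var 0)) else atom (Var 0)"
    have "ar P \<ge> 1 \<and> P \<in> sig_preds \<Theta> (ar P)" if "P \<in> F" for P
      unfolding ar_def by (rule someI_ex) (use that in \<open>auto simp: F_def\<close>)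
    then have "?sp P \<in> For \<Theta>" for P by (cases "P \<in> F"; force simp: atom_For)
    moreover have "inj_on ?sp F" by (auto intro!: inj_onI)
    ultimately show ?thesis unfolding F_def[symmetric] by (intro exI[of _ ?sp]) simp
  qed
  then obtain sp :: "'p \<Rightarrow> ('c, 'f, 'p) fm"
    where sp: "\<And>P. sp P \<in> For \<Theta>" "inj_on sp (\<Union>n\<in>{1..}. sig_preds \<Theta> n)"
    by blast
  interpret coding \<Theta> "For \<Theta>" "atom (Var 0)" "\<lambda>n a b. j (n, a, b)"
    "\<lambda>c. atom (if c \<in> sig_consts \<Theta> then Const c else Var 0)" sf sp
  proof
    show "atom (Var 0) \<in> For \<Theta>" by (simp add: atom_For)
    show "j (n, a, b) \<in> For \<Theta>" if "a \<in> For \<Theta>" "b \<in> For \<Theta>" for n a b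
      using conjunct2[OF j] that by auto
    show "n = n' \<and> a = a' \<and> b = b'"
      if "a \<in> For \<Theta>" "b \<in> For \<Theta>" "a' \<in> For \<Theta>" "b' \<in> For \<Theta>" "j (n, a, b) = j (n', a', b')"
      for n n' a a' b b'
      using inj_onD[OF conjunct1[OF j] that(5)] that by auto
    show "atom (if c \<in> sig_consts \<Theta> then Const c else Var 0) \<in> For \<Theta>" for c
      by (auto intro: atom_For)
    show "inj_on (\<lambda>c. atom (if c \<in> sig_consts \<Theta> then Const c else Var 0)) (sig_consts \<Theta>)"
      by (auto intro!: inj_onI dest: atom_inj)
  qed (use sf sp in auto)
  show ?thesis by (rule Ter_lepoll)
qed


section \<open>The two-element algebra\<close>

text \<open>The type of algebra elements is only known to have two distinct members, so the algebra
  lives on the image of \<open>bool\<close> under an injection.\<close>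

locale two_valued =
  fixes tv :: "bool \<Rightarrow> 'a"
  assumes tv_inj: "tv a = tv b \<longleftrightarrow> a = b"
begin

definition two :: "'a gorder" where
  "two = \<lparr>carrier = range tv, eq = (=), le = (\<lambda>x y. x = tv False \<or> y = tv True)\<rparr>"

lemma two_simps [simp]:
  "carrier two = range tv" "eq two = (=)" "le two x y \<longleftrightarrow> x = tv False \<or> y = tv True"
  by (auto simp: two_def)

lemma range_tv: "range tv = {tv False, tv True}"
  by (auto simp: UNIV_bool)

lemma least_Upper: "A \<subseteq> range tv \<Longrightarrow> least two s (Upper two A) \<longleftrightarrow> s = tv (tv True \<in> A)"
proof -
  assume "A \<subseteq> range tv"
  then have "A = {} \<or> A = {tv False} \<or> A = {tv True} \<or> A = {tv False, tv True}"
    unfolding range_tv by blast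
  then show ?thesis
    by (elim disjE) (auto simp: least_def Upper_def range_tv tv_inj)
qed

lemma greatest_Lower: "A \<subseteq> range tv \<Longrightarrow> greatest two s (Lower two A) \<longleftrightarrow> s = tv (tv False \<notin> A)"
proof -
  assume "A \<subseteq> range tv"
  then have "A = {} \<or> A = {tv False} \<or> A = {tv True} \<or> A = {tv False, tv True}"
    unfolding range_tv by blast
  then show ?thesis
    by (elim disjE) (auto simp: greatest_def Lower_def range_tv tv_inj)
qed

lemma sup_two: "A \<subseteq> range tv \<Longrightarrow> \<Squnion>\<^bsub>two\<^esub> A = tv (tv True \<in> A)"
  by (simp add: sup_def least_Upper)

lemma inf_two: "A \<subseteq> range tv \<Longrightarrow> \<Sqinter>\<^bsub>two\<^esub> A = tv (tv False \<notin> A)"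
  by (simp add: inf_def greatest_Lower)

lemma inf_image: "\<Sqinter>\<^bsub>two\<^esub> ((\<lambda>u. tv (P u)) ` S) = tv (\<forall>u\<in>S. P u)"
  by (subst inf_two) (auto simp: tv_inj)

lemma sup_image: "\<Squnion>\<^bsub>two\<^esub> ((\<lambda>u. tv (P u)) ` S) = tv (\<exists>u\<in>S. P u)"
  by (subst sup_two) (auto simp: tv_inj)

lemma join_two [simp]: "tv a \<squnion>\<^bsub>two\<^esub> tv b = tv (a \<or> b)"
  by (auto simp: join_def sup_two tv_inj)

lemma meet_two [simp]: "tv a \<sqinter>\<^bsub>two\<^esub> tv b = tv (a \<and> b)"
  by (auto simp: meet_def inf_two tv_inj)

lemma top_two [simp]: "\<top>\<^bsub>two\<^esub> = tv True"
  using inf_two[of "{}"] greatest_Lower[of "{}"] by (simp add: top_def Lower_def)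

lemma bottom_two [simp]: "\<bottom>\<^bsub>two\<^esub> = tv False"
  using least_Upper[of "{}"] by (simp add: bottom_def Upper_def)

sublocale two: complete_boolean_lattice two
proof -
  interpret partial_order two
    by unfold_locales (auto simp: tv_inj)
  interpret complete_lattice two
    by unfold_locales (auto simp: least_Upper greatest_Lower)
  show "complete_boolean_lattice two"
  proof unfold_locales
    fix x y z assume "x \<in> carrier two" "y \<in> carrier two" "z \<in> carrier two"
    then show "x \<sqinter>\<^bsub>two\<^esub> (y \<squnion>\<^bsub>two\<^esub> z) = (x \<sqinter>\<^bsub>two\<^esub> y) \<squnion>\<^bsub>two\<^esub> (x \<sqinter>\<^bsub>two\<^esub> z)"
      by (auto simp: tv_inj)
  next
    fix x assume "x \<in> carrier two"
    then obtain a where "x = tv a" by auto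
    then show "\<exists>y\<in>carrier two. x \<sqinter>\<^bsub>two\<^esub> y = \<bottom>\<^bsub>two\<^esub> \<and> x \<squnion>\<^bsub>two\<^esub> y = \<top>\<^bsub>two\<^esub>"
      by (intro bexI[of _ "tv (\<not> a)"]) auto
  qed
qed

lemma compl_two [simp]: "ba_compl two (tv a) = tv (\<not> a)"
  unfolding ba_compl_def by (rule the_equality) (auto simp: tv_inj)

lemma snapshots_two:
  "(tv a, tv b, tv c) \<in> snapshots two \<longleftrightarrow> (a \<or> b) \<and> \<not> (a \<and> b \<and> c)"
  by (auto simp: snapshots_def pr1_def pr2_def pr3_def tv_inj)

text \<open>The outputs are as large as the definition of swap structures permits. A snapshot is
  thus an admissible value as soon as its first coordinate is right.\<close>

definition full_swap :: "'a multialgebra" where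
  "full_swap = \<lparr>msnap = snapshots two,
     mbin = (\<lambda>b x y. {z \<in> snapshots two. pr1 z = ba_op two b (pr1 x) (pr1 y)}),
     mun = (\<lambda>u x. {z \<in> snapshots two. pr1 z = (case u of Neg \<Rightarrow> pr2 x | Circ \<Rightarrow> pr3 x)})\<rparr>"

lemma full_swap_simps [simp]:
  "msnap full_swap = snapshots two"
  "mbin full_swap b x y = {z \<in> snapshots two. pr1 z = ba_op two b (pr1 x) (pr1 y)}"
  "mun full_swap u x = {z \<in> snapshots two. pr1 z = (case u of Neg \<Rightarrow> pr2 x | Circ \<Rightarrow> pr3 x)}"
  by (simp_all add: full_swap_def)

lemma snapshot_exists: "r \<in> range tv \<Longrightarrow> \<exists>z\<in>snapshots two. pr1 z = r"
proof -
  assume "r \<in> range tv"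
  then obtain a where "r = tv a" by auto
  then show ?thesis
    \<comment> \<open>A classical second coordinate satisfies both snapshot conditions for either
      value of \<open>a\<close>.\<close>
    by (intro bexI[of _ "(tv a, tv (\<not> a), tv False)"]) (auto simp: snapshots_two pr1_def)
qed

lemma full_swap: "swap_structure two full_swap"
proof unfold_locales
  show "msnap full_swap \<noteq> {}" using snapshot_exists[of "tv True"] by auto
  show "msnap full_swap \<subseteq> snapshots two" by simp
next
  fix x y b assume "x \<in> msnap full_swap" "y \<in> msnap full_swap"
  then have "pr1 x \<in> range tv" "pr1 y \<in> range tv" by (auto simp: snapshots_def)
  then have "ba_op two b (pr1 x) (pr1 y) \<in> range tv" by (cases b) auto
  from snapshot_exists[OF this] show "mbin full_swap b x y \<noteq> {} \<and>
      mbin full_swap b x y \<subseteq> {z \<in> msnap full_swap. pr1 z = ba_op two b (pr1 x) (pr1 y)}"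
    by auto
next
  fix x assume "x \<in> msnap full_swap"
  then have "pr2 x \<in> range tv" "pr3 x \<in> range tv" by (auto simp: snapshots_def)
  from this[THEN snapshot_exists] show "mun full_swap Neg x \<noteq> {} \<and> mun full_swap Neg x \<subseteq> {z \<in> msnap full_swap. pr1 z = pr2 x}"
    "mun full_swap Circ x \<noteq> {} \<and> mun full_swap Circ x \<subseteq> {z \<in> msnap full_swap. pr1 z = pr3 x}"
    by auto
qed

end


section \<open>The canonical valuation\<close>

locale canonical = saturated "henkin_sig \<Theta>" \<Gamma> \<phi> + two_valued tv
  for \<Theta> :: "('c, 'f, 'p) fo_signature" and \<Gamma> \<phi> and tv :: "bool \<Rightarrow> 'a" +
  fixes e :: "(('c, 'f, 'p) hc, 'f) tm \<Rightarrow> 'u"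
  assumes sig: "is_signature \<Theta>"
    and \<phi>_For: "\<phi> \<in> For (henkin_sig \<Theta>)"
    and e_inj: "inj_on e (CTer (henkin_sig \<Theta>))"
begin

abbreviation "T \<alpha> \<equiv> qmbc_derivable (henkin_sig \<Theta>) \<Gamma> \<alpha>"
abbreviation "CT \<equiv> CTer (henkin_sig \<Theta>)"

text \<open>\<open>\<Theta>\<close> may have no constants, but a witness constant exists for every
  formula, in particular for an atom.\<close>

lemma CT_nonempty: "CT \<noteq> {}"
proof -
  obtain n P where n: "n \<ge> 1" "P \<in> sig_preds \<Theta> n" using sig by (auto simp: is_signature_def)
  then have "Pred P (replicate n (Var 0)) \<in> For (henkin_sig \<Theta>)" by auto
  then have "Const (Wit Forall 0 (Pred P (replicate n (Var 0)))) \<in> CT"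
    by (simp add: CTer_def hconst_Wit del: For_simps)
  then show ?thesis by auto
qed

text \<open>Outside the domain, \<open>d\<close> is still a closed term, so that the translation
  never introduces a free variable.\<close>

definition d :: "'u \<Rightarrow> (('c, 'f, 'p) hc, 'f) tm" where
  "d u = (if u \<in> e ` CT then inv_into CT e u else (SOME t. t \<in> CT))"

lemma d_in [simp]: "d u \<in> CT"
  using CT_nonempty by (auto simp: d_def inv_into_into some_in_eq)

lemma d_e [simp]: "t \<in> CT \<Longrightarrow> d (e t) = t"
  using e_inj by (auto simp: d_def)

lemma e_d: "u \<in> e ` CT \<Longrightarrow> e (d u) = u"
  by (auto simp: d_def f_inv_into_f)

lemma tm_vars_d [simp]: "tm_vars (d u) = {}"
  using d_in[of u] by (simp add: CTer_def)

lemma d_Ter [simp]: "d u \<in> Ter (henkin_sig \<Theta>)"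
  using d_in[of u] by (simp add: CTer_def)

definition \<kappa> :: "'c + 'u \<Rightarrow> (('c, 'f, 'p) hc, 'f) tm" where
  "\<kappa> = case_sum (\<lambda>c. Const (Orig c)) d"

lemma \<kappa>_simps [simp]: "\<kappa> (Inl c) = Const (Orig c)" "\<kappa> (Inr u) = d u"
  by (simp_all add: \<kappa>_def)

lemma crange_\<kappa> [simp]: "crange \<kappa> = {}"
  by (auto simp: crange_def \<kappa>_def split: sum.splits)

abbreviation "tr \<equiv> fm_csub \<kappa>"

definition snap :: "(('c, 'f, 'p) hc, 'f, 'p) fm \<Rightarrow> 'a snapshot" where
  "snap \<alpha> = (tv (T \<alpha>), tv (T (\<^bold>\<not> \<alpha>)), tv (T (\<^bold>\<circ> \<alpha>)))"

definition model :: "('c, 'f, 'p, 'u, 'a) fo_structure" where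
  "model = \<lparr>udom = e ` CT, iconst = (\<lambda>c. e (Const (Orig c))),
     ifun = (\<lambda>f us. e (Fun f (map d us))), ipred = (\<lambda>P us. snap (Pred P (map d us)))\<rparr>"

lemma model_sel [simp]:
  "udom model = e ` CT" "iconst model c = e (Const (Orig c))"
  "ifun model f us = e (Fun f (map d us))" "ipred model P us = snap (Pred P (map d us))"
  by (simp_all add: model_def)

lemma diag_sig_sel [simp]:
  "sig_consts (diag_sig \<Theta> model) = Inl ` sig_consts \<Theta> \<union> Inr ` e ` CT"
  "sig_funs (diag_sig \<Theta> model) = sig_funs \<Theta>" "sig_preds (diag_sig \<Theta> model) = sig_preds \<Theta>"
  by (simp_all add: diag_sig_def)

lemma pr_snap [simp]:
  "pr1 (snap \<alpha>) = tv (T \<alpha>)" "pr2 (snap \<alpha>) = tv (T (\<^bold>\<not> \<alpha>))" "pr3 (snap \<alpha>) = tv (T (\<^bold>\<circ> \<alpha>))"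
  by (simp_all add: snap_def pr1_def pr2_def pr3_def)

lemma snap_in: "\<alpha> \<in> Sen (henkin_sig \<Theta>) \<Longrightarrow> snap \<alpha> \<in> snapshots two"
  using derives_neg[of \<alpha>] derives_circ[OF \<phi>_For, of \<alpha>] by (auto simp: snap_def snapshots_two)

lemma \<kappa>_Ter: "c \<in> sig_consts (diag_sig \<Theta> model) \<Longrightarrow> \<kappa> c \<in> Ter (henkin_sig \<Theta>)"
  by (auto simp del: d_e)

lemma tr_tm_Ter: "t \<in> Ter (diag_sig \<Theta> model) \<Longrightarrow> tm_csub \<kappa> t \<in> Ter (henkin_sig \<Theta>)"
  by (rule tm_csub_Ter[OF _ \<kappa>_Ter]) auto

lemma tr_For: "\<psi> \<in> For (diag_sig \<Theta> model) \<Longrightarrow> tr \<psi> \<in> For (henkin_sig \<Theta>)"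
  by (rule fm_csub_For[OF _ \<kappa>_Ter]) auto

lemma fv_tr [simp]: "fv (tr \<psi>) = fv \<psi>"
  using fv_csub[of \<kappa> \<psi>] by simp

lemma tm_vars_tr [simp]: "tm_vars (tm_csub \<kappa> t) = tm_vars t"
  using tm_vars_csub[of \<kappa> t] by simp

lemma tr_Sen: "\<psi> \<in> Sen (diag_sig \<Theta> model) \<Longrightarrow> tr \<psi> \<in> Sen (henkin_sig \<Theta>)"
  by (simp add: Sen_def tr_For)

lemma tr_inst: "tr (fm_inst \<sigma> \<psi>) = fm_inst (\<lambda>x. tm_csub \<kappa> (\<sigma> x)) (tr \<psi>)"
  by (rule fm_csub_inst) simp

lemma tr_subst_name: "tr (\<psi>[x//name_of u]) = (tr \<psi>)[x//d u]"
  by (simp add: fm_csub_subst)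

text \<open>The term-model property: a term evaluates to the element standing for its own ground
  instance. The second claim lets \<open>d\<close> undo \<open>e\<close> on the arguments in the
  induction.\<close>

lemma diag_val:
  assumes "t \<in> Ter (diag_sig \<Theta> model)" "assignment model \<mu>"
  shows "diag_val model \<mu> t = e (tm_csub \<kappa> (tm_inst (\<lambda>x. name_of (\<mu> x)) t))"
    and "tm_csub \<kappa> (tm_inst (\<lambda>x. name_of (\<mu> x)) t) \<in> CT"
proof -
  let ?\<sigma> = "\<lambda>x. name_of (\<mu> x) :: ('c + 'u, 'f) tm"
  have \<mu>: "\<mu> x \<in> e ` CT" for x using assms(2) by (auto simp: assignment_def)
  have CT: "tm_csub \<kappa> (tm_inst ?\<sigma> t) \<in> CT" if "t \<in> Ter (diag_sig \<Theta> model)" for t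
    using that \<mu> by (auto simp: CTer_def tm_vars_inst intro!: tr_tm_Ter tm_inst_Ter)
  then show "tm_csub \<kappa> (tm_inst ?\<sigma> t) \<in> CT" using assms(1) .
  show "diag_val model \<mu> t = e (tm_csub \<kappa> (tm_inst ?\<sigma> t))"
    using assms(1)
  proof (induction t rule: tm.induct)
    case (Var x)
    then show ?case using \<mu> by (simp add: e_d)
  next
    case (Const c)
    then show ?case by (auto simp: diag_structure_def e_d)
  next
    case (Fun f ts)
    have "d (diag_val model \<mu> t) = tm_csub \<kappa> (tm_inst ?\<sigma> t)" if "t \<in> set ts" for t
      using Fun that CT[of t] by auto
    then have "map d (map (diag_val model \<mu>) ts) = map (tm_csub \<kappa>) (map (tm_inst ?\<sigma>) ts)"
      by simp
    then show ?case by (simp add: diag_structure_def del: map_map)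
  qed
qed

text \<open>Because \<open>t\<close> is free for \<open>z\<close>, both sides are instances of
  \<open>\<chi>\<close> that can differ only at \<open>z\<close>. There they carry the ground form
  of \<open>t\<close> and the term \<open>d b\<close>, which \<open>diag_val\<close>
  identifies.\<close>

lemma tr_ground_subst:
  assumes "free_for t z \<chi>" "t \<in> Ter (diag_sig \<Theta> model)" "assignment model \<mu>"
    "b = diag_val model \<mu> t"
  shows "tr (ground \<mu> (\<chi>[z//t])) = tr (ground \<mu> (\<chi>[z//name_of b]))"
proof -
  let ?\<sigma> = "\<lambda>x. name_of (\<mu> x) :: ('c + 'u, 'f) tm"
  have "tm_csub \<kappa> (tm_inst ?\<sigma> t) = d b"
    using diag_val[OF assms(2,3)] assms(4) by simp
  then have "(\<lambda>y. tm_csub \<kappa> ((?\<sigma>(z := tm_inst ?\<sigma> t)) y)) = (\<lambda>y. tm_csub \<kappa> ((?\<sigma>(z := name_of b)) y))"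
    by auto
  moreover have "free_for (name_of b) z \<chi>" by (simp add: free_for_closed)
  ultimately show ?thesis
    using assms(1) by (simp add: ground_def fm_inst_subst tr_inst del: fun_upd_apply)
qed

lemma canonical_valuation: "qmbc_valuation \<Theta> two full_swap model (\<lambda>\<psi>. snap (tr \<psi>))"
proof
  fix \<psi> assume "\<psi> \<in> Sen (diag_sig \<Theta> model)"
  then show "snap (tr \<psi>) \<in> msnap full_swap" by (simp add: snap_in tr_Sen)
next
  fix ts :: "('c + 'u, 'f) tm list" and P \<mu>
  assume ts: "set ts \<subseteq> CTer (diag_sig \<Theta> model)" and \<mu>: "assignment model \<mu>"
  have "d (diag_val model \<mu> t) = tm_csub \<kappa> t" if "t \<in> set ts" for t
  proof -
    have "t \<in> Ter (diag_sig \<Theta> model)" "tm_inst (\<lambda>x. name_of (\<mu> x)) t = t"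
      using ts that by (auto simp: CTer_def intro: tm_inst_ident)
    then show ?thesis using diag_val[of t \<mu>] \<mu> by simp
  qed
  then show "snap (tr (Pred P ts)) = ipred model P (map (diag_val model \<mu>) ts)"
    by (simp cong: map_cong)
next
  fix \<psi> uop assume "\<psi> \<in> Sen (diag_sig \<Theta> model)"
  then have "Unary uop (tr \<psi>) \<in> Sen (henkin_sig \<Theta>)"
    using tr_Sen[of \<psi>] by (simp add: Sen_def)
  then show "snap (tr (Unary uop \<psi>)) \<in> mun full_swap uop (snap (tr \<psi>))"
    by (auto simp: snap_in split: unop.splits)
next
  fix \<psi> \<chi> bop assume "\<psi> \<in> Sen (diag_sig \<Theta> model)" "\<chi> \<in> Sen (diag_sig \<Theta> model)"
  then have S: "tr \<psi> \<in> Sen (henkin_sig \<Theta>)" "tr \<chi> \<in> Sen (henkin_sig \<Theta>)" by (auto intro: tr_Sen)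
  then have "Binary bop (tr \<psi>) (tr \<chi>) \<in> Sen (henkin_sig \<Theta>)" by (simp add: Sen_def)
  then show "snap (tr (Binary bop \<psi> \<chi>)) \<in> mbin full_swap bop (snap (tr \<psi>)) (snap (tr \<chi>))"
    using derives_and[OF S] derives_or[OF S] derives_imp[OF S]
    by (cases bop) (auto simp: snap_in tv_inj)
next
  fix x \<psi> assume "Quant Forall x \<psi> \<in> Sen (diag_sig \<Theta> model)"
  then have "Quant Forall x (tr \<psi>) \<in> Sen (henkin_sig \<Theta>)" using tr_Sen by fastforce
  then have "T (Quant Forall x (tr \<psi>)) \<longleftrightarrow> (\<forall>u\<in>e ` CT. T ((tr \<psi>)[x//d u]))"
    by (simp add: derives_all)
  moreover have A: "{pr1 (snap (tr (\<psi>[x//name_of a]))) | a. a \<in> udom model} =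
      (\<lambda>u. tv (T ((tr \<psi>)[x//d u]))) ` e ` CT"
    by (auto simp: tr_subst_name)
  ultimately show "pr1 (snap (tr (Quant Forall x \<psi>))) =
      \<Sqinter>\<^bsub>two\<^esub> {pr1 (snap (tr (\<psi>[x//name_of a]))) | a. a \<in> udom model}"
    unfolding A inf_image by simp
next
  fix x \<psi> assume "Quant Exists x \<psi> \<in> Sen (diag_sig \<Theta> model)"
  then have "Quant Exists x (tr \<psi>) \<in> Sen (henkin_sig \<Theta>)" using tr_Sen by fastforce
  then have "T (Quant Exists x (tr \<psi>)) \<longleftrightarrow> (\<exists>u\<in>e ` CT. T ((tr \<psi>)[x//d u]))"
    by (simp add: derives_ex)
  moreover have A: "{pr1 (snap (tr (\<psi>[x//name_of a]))) | a. a \<in> udom model} =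
      (\<lambda>u. tv (T ((tr \<psi>)[x//d u]))) ` e ` CT"
    by (auto simp: tr_subst_name)
  ultimately show "pr1 (snap (tr (Quant Exists x \<psi>))) =
      \<Squnion>\<^bsub>two\<^esub> {pr1 (snap (tr (\<psi>[x//name_of a]))) | a. a \<in> udom model}"
    unfolding A sup_image by simp
next
  fix \<psi> :: "('c + 'u, 'f, 'p) fm" and t z \<mu> b uop
  assume "t \<in> Ter (diag_sig \<Theta> model)" "free_for t z \<psi>" "assignment model \<mu>" "b = diag_val model \<mu> t"
  then show "snap (tr (ground \<mu> ((Unary uop \<psi>)[z//t]))) = snap (tr (ground \<mu> ((Unary uop \<psi>)[z//name_of b])))"
    by (subst tr_ground_subst) auto
next
  fix \<psi> \<chi> :: "('c + 'u, 'f, 'p) fm" and t z \<mu> b bop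
  assume "t \<in> Ter (diag_sig \<Theta> model)" "free_for t z \<psi>" "free_for t z \<chi>" "assignment model \<mu>"
    "b = diag_val model \<mu> t"
  then show "snap (tr (ground \<mu> ((Binary bop \<psi> \<chi>)[z//t]))) = snap (tr (ground \<mu> ((Binary bop \<psi> \<chi>)[z//name_of b])))"
    by (subst tr_ground_subst) auto
next
  fix \<psi> :: "('c + 'u, 'f, 'p) fm" and t z \<mu> b x Q
  assume "t \<in> Ter (diag_sig \<Theta> model)" "free_for t z \<psi>" "assignment model \<mu>"
    "b = diag_val model \<mu> t" "x \<notin> tm_vars t"
  \<comment> \<open>As \<open>x\<close> is not in \<open>t\<close>, the term is free for
    \<open>z\<close> in the quantified formula as well.\<close>
  then show "snap (tr (ground \<mu> ((Quant Q x \<psi>)[z//t]))) = snap (tr (ground \<mu> ((Quant Q x \<psi>)[z//name_of b])))"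
    by (subst tr_ground_subst) auto
next
  fix \<psi> \<psi>' assume S: "\<psi> \<in> Sen (diag_sig \<Theta> model)" "\<psi>' \<in> Sen (diag_sig \<Theta> model)" and "variant \<psi> \<psi>'"
  then have "variant (tr \<psi>) (tr \<psi>')"
    \<comment> \<open>\<open>\<kappa>\<close> brings in no variables, so a family constant in
      \<open>y\<close> is allowed, and for it the cofinite statement is the plain one.\<close>
    using variant_csub[of \<psi> \<psi>' "\<lambda>_. \<kappa>"] by simp
  moreover have "tr \<psi> \<in> For (henkin_sig \<Theta>)" "tr \<psi>' \<in> For (henkin_sig \<Theta>)"
    using S by (auto simp: Sen_def tr_For)
  \<comment> \<open>The second and third coordinates are handled by the congruence rule for
    \<open>variant\<close>: negations and consistency statements of variants are variants.\<close>
  ultimately have "T (tr \<psi>) = T (tr \<psi>')" "T (Unary u (tr \<psi>)) = T (Unary u (tr \<psi>'))" for u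
    using derives_variant[of "tr \<psi>" "tr \<psi>'"] derives_variant[OF variant.Unary, of "tr \<psi>" "tr \<psi>'" u]
    by auto
  then show "snap (tr \<psi>) = snap (tr \<psi>')" by (simp add: snap_def)
qed

lemma canonical_structure: "is_structure \<Theta> full_swap model"
  unfolding is_structure_def
proof (intro conjI ballI allI impI)
  show "udom model \<noteq> {}" using CT_nonempty by simp
  show "iconst model c \<in> udom model" if "c \<in> sig_consts \<Theta>" for c
    using that by (auto simp: CTer_def)
  show "ifun model f us \<in> udom model"
    if "1 \<le> n" "f \<in> sig_funs \<Theta> n" "us \<in> lists (udom model)" "length us = n" for n f us
    using that by (auto simp: CTer_def intro!: imageI)
  show "ipred model P us \<in> msnap full_swap"
    if "1 \<le> n" "P \<in> sig_preds \<Theta> n" "us \<in> lists (udom model)" "length us = n" for n P us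
    using that by (auto simp: Sen_def intro!: snap_in)
qed

section \<open>Truth of closed instances in the canonical model\<close>

lemma tr_ground_lift: "tr (ground \<mu> (lift_fm \<psi>)) = fm_inst (\<lambda>x. d (\<mu> x)) (orig \<psi>)"
  by (simp add: ground_def lift_fm_def map_fm_csub tr_inst fm_csub_csub orig_def)

lemma inst_Sen:
  assumes "\<psi> \<in> For (henkin_sig \<Theta>)" "\<And>x. \<sigma> x \<in> CT"
  shows "fm_inst \<sigma> \<psi> \<in> Sen (henkin_sig \<Theta>)"
  using assms fv_inst_subset[of \<sigma> \<psi>] by (auto simp: Sen_def CTer_def intro: fm_inst_For)

text \<open>This truth lemma takes no induction on formulas: the valuation is defined from
  derivability, and the clauses for connectives and quantifiers were checked in showing it to be a
  valuation.\<close>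

lemma designated_iff:
  assumes "\<psi> \<in> For \<Theta>"
  shows "snap (tr (ground \<mu> (lift_fm \<psi>))) \<in> designated two full_swap \<longleftrightarrow>
    T (fm_inst (\<lambda>x. d (\<mu> x)) (orig \<psi>))"
  using assms by (simp add: designated_def tr_ground_lift snap_in inst_Sen orig_For tv_inj)

text \<open>Saturation derives a universal sentence from its closed instances, and each quantifier
  removed redirects \<open>\<sigma>\<close> at its variable to an arbitrary closed term. Hence the
  induction varies \<open>\<sigma>\<close>.\<close>

lemma derives_closure:
  assumes "\<chi> \<in> For (henkin_sig \<Theta>)"
    and "\<And>\<sigma>. (\<And>x. \<sigma> x \<in> CT) \<Longrightarrow> T (fm_inst \<sigma> \<chi>)" "\<And>x. \<sigma> x \<in> CT"
  shows "T (fm_inst \<sigma> (foldr (Quant Forall) xs \<chi>))"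
  using assms(3)
proof (induction xs arbitrary: \<sigma>)
  case Nil
  then show ?case using assms(2) by simp
next
  case (Cons x xs)
  let ?\<chi> = "foldr (Quant Forall) xs \<chi>"
  have F: "?\<chi> \<in> For (henkin_sig \<Theta>)" using assms(1) by (induction xs) auto
  have "T ((fm_inst (\<sigma>(x := Var x)) ?\<chi>)[x//t])" if "t \<in> CT" for t
  proof -
    have "T (fm_inst (\<sigma>(x := t)) ?\<chi>)" using Cons that by (intro Cons.IH) auto
    then show ?thesis using Cons.prems by (subst subst_inst_closed) (auto simp: CTer_def)
  qed
  moreover have "Quant Forall x (fm_inst (\<sigma>(x := Var x)) ?\<chi>) \<in> Sen (henkin_sig \<Theta>)"
    using inst_Sen[of "Quant Forall x ?\<chi>" \<sigma>] F Cons.prems by simp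
  ultimately show ?case by (simp add: derives_all)
qed

end

section \<open>Universal closure and completeness\<close>

lemma derivable_closure:
  assumes "\<Gamma> \<subseteq> For \<Theta>" "qmbc_derivable \<Theta> \<Gamma> (foldr (Quant Forall) xs \<phi>)"
  shows "qmbc_derivable \<Theta> \<Gamma> \<phi>"
  using assms(2)
proof (induction xs)
  case (Cons x xs)
  interpret hypotheses \<Theta> \<Gamma> by unfold_locales fact
  show ?case
    using all_elim[of x "foldr (Quant Forall) xs \<phi>" "Var x"] Cons by (simp add: free_for_self)
qed simp

lemma fv_closure: "fv (foldr (Quant Forall) xs \<phi>) = fv \<phi> - set xs"
  by (induction xs) auto

lemma orig_closure: "orig (foldr (Quant Forall) xs \<phi>) = foldr (Quant Forall) xs (orig \<phi>)"
  by (induction xs) (auto simp: orig_def)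

theorem corollary8p14:
  fixes \<Theta> :: "('c, 'f, 'p) fo_signature"
    and \<Gamma> :: "('c, 'f, 'p) fm set"
    and \<phi> :: "('c, 'f, 'p) fm"
  assumes "is_signature \<Theta>"
    and "\<Gamma> \<subseteq> For \<Theta>"
    and "\<phi> \<in> For \<Theta>"
    and "\<exists>x y :: 'a. x \<noteq> y"
    and "For \<Theta> \<lesssim> (UNIV :: 'u set)"
    and "qmbc_conseq TYPE('a) TYPE('u) \<Theta> \<Gamma> \<phi>"
  shows "qmbc_derivable \<Theta> \<Gamma> \<phi>"
proof (rule ccontr)
  assume "\<not> qmbc_derivable \<Theta> \<Gamma> \<phi>"
  obtain xs where xs: "set xs = fv \<phi>" using finite_list[OF finite_fv] by blast
  let ?\<phi> = "foldr (Quant Forall) xs \<phi>"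
  have F: "?\<phi> \<in> For \<Theta>" using assms(3) by (induction xs) auto
  have "\<not> qmbc_derivable \<Theta> \<Gamma> ?\<phi>"
    using derivable_closure[OF assms(2)] \<open>\<not> qmbc_derivable \<Theta> \<Gamma> \<phi>\<close> by blast
  then obtain \<Delta> where \<Delta>: "saturated (henkin_sig \<Theta>) \<Delta> (orig ?\<phi>)" "orig ` \<Gamma> \<subseteq> \<Delta>"
    by (rule henkin_theory[OF assms(2)])
  obtain x y :: 'a where "x \<noteq> y" using assms(4) by blast
  define tv where "tv b = (if b then x else y)" for b
  have "Ter (henkin_sig \<Theta>) \<lesssim> (UNIV :: 'u set)"
    using henkin_terms_lepoll[OF assms(1)] assms(5) by (rule lepoll_trans)
  then obtain e :: "(('c, 'f, 'p) hc, 'f) tm \<Rightarrow> 'u" where "inj_on e (Ter (henkin_sig \<Theta>))"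
    unfolding lepoll_def by blast
  then have e: "inj_on e (CTer (henkin_sig \<Theta>))" by (rule inj_on_subset) (auto simp: CTer_def)
  interpret saturated "henkin_sig \<Theta>" \<Delta> "orig ?\<phi>" by fact
  interpret canonical \<Theta> \<Delta> "orig ?\<phi>" tv e
    by unfold_locales (use \<open>x \<noteq> y\<close> assms(1) F e in \<open>auto simp: tv_def orig_For\<close>)
  let ?v = "\<lambda>\<psi>. snap (tr \<psi>)"
  \<comment> \<open>Holds for arbitrary \<open>\<mu>\<close>, since \<open>d\<close> sends every
    element of the type to a closed term. The premise may be open: a derivable formula has all its
    closed instances derivable.\<close>
  have "?v (ground \<mu> (lift_fm \<gamma>)) \<in> designated two full_swap" if "\<gamma> \<in> \<Gamma>" for \<gamma> \<mu>
  proof -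
    have "T (orig \<gamma>)" using that \<Delta>(2) by (auto intro: qmbc_derivable.Premise)
    then have "T (fm_inst (\<lambda>x. d (\<mu> x)) (orig \<gamma>))" by (rule inst_closed) simp
    then show ?thesis using designated_iff assms(2) that by blast
  qed
  moreover have "conseq_in \<Theta> two full_swap model \<Gamma> \<phi>"
    using assms(6) two.complete_boolean_lattice_axioms full_swap canonical_structure
    unfolding qmbc_conseq_def by blast
  ultimately have \<mu>: "?v (ground \<mu> (lift_fm \<phi>)) \<in> designated two full_swap" if "assignment model \<mu>" for \<mu>
    using canonical_valuation that unfolding conseq_in_def by blast
  \<comment> \<open>Every closed instance comes from an assignment, namely \<open>e\<close> after
    \<open>\<sigma>\<close>, which \<open>d\<close> undoes.\<close>
  have inst: "T (fm_inst \<sigma> (orig \<phi>))" if "\<And>x. \<sigma> x \<in> CT" for \<sigma>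
  proof -
    have "T (fm_inst (\<lambda>x. d (e (\<sigma> x))) (orig \<phi>))"
      using \<mu>[of "\<lambda>x. e (\<sigma> x)"] that designated_iff[OF assms(3)] by (auto simp: assignment_def)
    then show ?thesis using that by simp
  qed
  \<comment> \<open>The choice of \<open>t\<close> is immaterial: the closure is a sentence, so
    instantiating it changes nothing.\<close>
  obtain t where "t \<in> CT" using CT_nonempty by blast
  then have "T (fm_inst (\<lambda>_. t) (foldr (Quant Forall) xs (orig \<phi>)))"
    using assms(3) by (intro derives_closure inst) (auto simp: orig_For)
  moreover have "fv (orig ?\<phi>) = {}"
    using fv_csub[of "\<lambda>c. Const (Orig c)" ?\<phi>] xs by (auto simp: orig_def crange_def fv_closure)
  ultimately have "T (orig ?\<phi>)" 
    using fm_inst_ident[of "orig ?\<phi>" "\<lambda>_. t"] by (simp add: orig_closure[symmetric])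
  then show False using not_derives by blast
qed

end
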